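(* Let $u,w\in\mathcal{D}(E)$ be such that $M_wEM_u$ is a bounded operator on $L^2(\Sigma)$. For $\lambda\in\mathbb{C}$ let $A_{\lambda,w}=\{x\in X: E(uw)(x)=\lambda\}$. If $|E(uw)|=E(|u|^2)(E(|w|^2))^{\frac12}$ on $S=S(E(|u|^2))$, then: (a) $\sigma_{jp}(M_wEM_u)\setminus\{0\}=\sigma_p(M_wEM_u)\setminus\{0\}=\{\lambda\in\mathbb{C}:\mu(A_{\lambda,w})>0\}\setminus\{0\}$. (b) $\sigma(M_wEM_u)\setminus\{0\}=\{\lambda:\bar{\lambda}\in\sigma_{ap}(M_{\bar u}EM_{\bar w})\}\setminus\{0\}$. (c) If $\lambda$ is an isolated point in $\sigma(M_wEM_u)$, then $\lambda\in\sigma_p(M_wEM_u)$.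
   Context: $(X,\Sigma,\mu)$ is a complete $\sigma$-finite measure space and $\mathcal{A}\subseteq\Sigma$ is a $\sigma$-subalgebra such that $\mu|_{\mathcal{A}}$ is $\sigma$-finite. $L^2(\Sigma)=L^2(X,\Sigma,\mu)$ (complex-valued functions). $L^0(\Sigma)$ (resp. $L^0(\mathcal{A})$) denotes the a.e. finite valued $\Sigma$-measurable (resp. $\mathcal{A}$-measurable) functions modulo null sets. All comparisons between functions or sets are up to $\mu$-null sets. The support of a measurable function $f$ is $S(f)=\{x\in X: f(x)\ne 0\}$. $E=E^{\mathcal{A}}$ is the conditional expectation: for $f\ge 0$ measurable or $f\in L^2(\Sigma)$, $E(f)$ is the unique $\mathcal{A}$-measurable function with $\int_A f\,d\mu=\int_A E(f)\,d\mu$ for all $A\in\mathcal{A}$ (for which the integrals are defined). $\mathcal{D}(E)=\{g\in L^0(\Sigma): E(|g|)\in L^0(\mathcal{A})\}$, on which $E$ is defined by linearity. $M_wEM_u$ is the operator $f\mapsto wE(uf)$, and $M_{\bar u}EM_{\bar w}$ is $f\mapsto \bar uE(\bar wf)$. For a bounded operator $T$: $\sigma(T)$ is the spectrum; $\sigma_p(T)$ is the point spectrum, the set of $\lambda\in\mathbb{C}$ for which there is a unit vector $x$ with $(T-\lambda)x=0$; $\sigma_{jp}(T)$ is the joint point spectrum, the set of $\lambda$ for which there is a unit vector $x$ with $(T-\lambda)x=0$ and $(T^*-\bar\lambda)x=0$; $\sigma_{ap}(T)$ is the approximate point spectrum, the set of $\lambda$ such that $T-\lambda I$ is not bounded below.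
   Formalization: The hypothesis is corrected to |E(uw)| = (E(|u|²))^{1/2}(E(|w|²))^{1/2} on S; as printed, with E(|u|²) to the first power, part (a) fails, e.g. on two points of mass 1/2 with A trivial, u=(1/√2,0), w=(1/√2,√(3/2)). *)

theory Defs
  imports "HOL-Probability.Conditional_Expectation" "HOL-Analysis.Isolated"
begin

section \<open>Conditional expectation of complex functions\<close>

text \<open>For \<open>g\<close> in \<open>cond_exp_dom M F\<close> the nonnegative parts entering
  \<^const>\<open>real_cond_exp\<close> of the real and imaginary part of \<open>g\<close> have almost everywhere finite
  conditional expectation, so \<open>complex_cond_exp M F g\<close> is the extension of the conditional
  expectation by linearity.\<close>

definition cond_exp_dom :: "'a measure \<Rightarrow> 'a measure \<Rightarrow> ('a \<Rightarrow> complex) set" where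
  "cond_exp_dom M F =
     {g \<in> borel_measurable M. AE x in M. nn_cond_exp M F (\<lambda>y. ennreal (cmod (g y))) x < \<infinity>}"

definition complex_cond_exp ::
    "'a measure \<Rightarrow> 'a measure \<Rightarrow> ('a \<Rightarrow> complex) \<Rightarrow> 'a \<Rightarrow> complex" where
  "complex_cond_exp M F g =
     (\<lambda>x. Complex (real_cond_exp M F (\<lambda>y. Re (g y)) x) (real_cond_exp M F (\<lambda>y. Im (g y)) x))"

text \<open>The operator \<open>M\<^sub>w E M\<^sub>u\<close>. Nothing is assumed about \<open>u f\<close> lying in the domain of \<open>E\<close>
  at points where \<open>w\<close> vanishes: the product is \<open>0\<close> there in any case (convention
  \<open>0 \<cdot> \<infinity> = 0\<close>). Boundedness of the operator in the sense of \<open>bounded_L2_op\<close> below,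
  tested on \<open>f = cnj u \<cdot> g\<close> with \<open>u\<close> truncated and \<open>g\<close> measurable with respect to \<open>F\<close>, already
  forces \<open>E(|u|\<^sup>2) E(|w|\<^sup>2)\<close> to be essentially bounded. Hence \<open>E(|u f|) < \<infinity>\<close> almost
  everywhere on the support of \<open>w\<close>, for every \<open>f\<close> in \<open>L\<^sup>2\<close>, and symmetrically
  \<open>E(|w f|) < \<infinity>\<close> almost everywhere on the support of \<open>u\<close>.\<close>

definition weighted_cond_exp ::
    "'a measure \<Rightarrow> 'a measure \<Rightarrow> ('a \<Rightarrow> complex) \<Rightarrow> ('a \<Rightarrow> complex)
      \<Rightarrow> ('a \<Rightarrow> complex) \<Rightarrow> ('a \<Rightarrow> complex)" where
  "weighted_cond_exp M F w u f = (\<lambda>x. w x * complex_cond_exp M F (\<lambda>y. u y * f y) x)"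

section \<open>The Hilbert space \<open>L\<^sup>2\<close> and its operators\<close>

text \<open>Elements of \<open>L\<^sup>2\<close> are represented by square integrable functions and equality in \<open>L\<^sup>2\<close>
  by equality almost everywhere. An operator is a map on representatives; linearity and
  boundedness together make it respect equality almost everywhere.\<close>

definition L2_space :: "'a measure \<Rightarrow> ('a \<Rightarrow> complex) set" where
  "L2_space M = {f \<in> borel_measurable M. integrable M (\<lambda>x. (cmod (f x))\<^sup>2)}"

definition L2_norm :: "'a measure \<Rightarrow> ('a \<Rightarrow> complex) \<Rightarrow> real" where
  "L2_norm M f = sqrt (\<integral>x. (cmod (f x))\<^sup>2 \<partial>M)"

definition L2_inner :: "'a measure \<Rightarrow> ('a \<Rightarrow> complex) \<Rightarrow> ('a \<Rightarrow> complex) \<Rightarrow> complex" where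
  "L2_inner M f g = (\<integral>x. f x * cnj (g x) \<partial>M)"

definition bounded_L2_op ::
    "'a measure \<Rightarrow> (('a \<Rightarrow> complex) \<Rightarrow> ('a \<Rightarrow> complex)) \<Rightarrow> bool" where
  "bounded_L2_op M T \<longleftrightarrow>
     (\<forall>f\<in>L2_space M. T f \<in> L2_space M) \<and>
     (\<forall>f\<in>L2_space M. \<forall>g\<in>L2_space M. AE x in M. T (\<lambda>y. f y + g y) x = T f x + T g x) \<and>
     (\<forall>c. \<forall>f\<in>L2_space M. AE x in M. T (\<lambda>y. c * f y) x = c * T f x) \<and>
     (\<exists>C. \<forall>f\<in>L2_space M. L2_norm M (T f) \<le> C * L2_norm M f)"

text \<open>The adjoint is unique up to equality almost everywhere of its values, so that the choice
  below is immaterial wherever \<open>L2_adjoint\<close> is used.\<close>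

definition L2_adjoint ::
    "'a measure \<Rightarrow> (('a \<Rightarrow> complex) \<Rightarrow> ('a \<Rightarrow> complex)) \<Rightarrow> ('a \<Rightarrow> complex) \<Rightarrow> ('a \<Rightarrow> complex)"
  where
  "L2_adjoint M T = (SOME S. bounded_L2_op M S \<and>
     (\<forall>f\<in>L2_space M. \<forall>g\<in>L2_space M. L2_inner M (T f) g = L2_inner M f (S g)))"

section \<open>Parts of the spectrum\<close>

definition L2_spectrum ::
    "'a measure \<Rightarrow> (('a \<Rightarrow> complex) \<Rightarrow> ('a \<Rightarrow> complex)) \<Rightarrow> complex set" where
  "L2_spectrum M T = {z. \<not> (\<exists>R. bounded_L2_op M R \<and>
     (\<forall>f\<in>L2_space M. (AE x in M. R (\<lambda>y. T f y - z * f y) x = f x) \<and>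
                      (AE x in M. T (R f) x - z * R f x = f x)))}"

definition L2_point_spectrum ::
    "'a measure \<Rightarrow> (('a \<Rightarrow> complex) \<Rightarrow> ('a \<Rightarrow> complex)) \<Rightarrow> complex set" where
  "L2_point_spectrum M T =
     {z. \<exists>f\<in>L2_space M. L2_norm M f = 1 \<and> (AE x in M. T f x - z * f x = 0)}"

definition L2_joint_point_spectrum ::
    "'a measure \<Rightarrow> (('a \<Rightarrow> complex) \<Rightarrow> ('a \<Rightarrow> complex)) \<Rightarrow> complex set" where
  "L2_joint_point_spectrum M T =
     {z. \<exists>f\<in>L2_space M. L2_norm M f = 1 \<and> (AE x in M. T f x - z * f x = 0) \<and>
           (AE x in M. L2_adjoint M T f x - cnj z * f x = 0)}"

definition L2_approx_point_spectrum ::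
    "'a measure \<Rightarrow> (('a \<Rightarrow> complex) \<Rightarrow> ('a \<Rightarrow> complex)) \<Rightarrow> complex set" where
  "L2_approx_point_spectrum M T =
     {z. \<not> (\<exists>c>0. \<forall>f\<in>L2_space M. c * L2_norm M f \<le> L2_norm M (\<lambda>x. T f x - z * f x))}"

section \<open>The Cauchy-Schwarz equality hypothesis\<close>

text \<open>The theorem assumes equality in the conditional Cauchy-Schwarz inequality
  \<open>|E(uw)| \<le> (E(|u|\<^sup>2))\<^sup>1\<^sup>/\<^sup>2 (E(|w|\<^sup>2))\<^sup>1\<^sup>/\<^sup>2\<close> on the support of \<open>E(|u|\<^sup>2)\<close>. The exponent
  \<open>1/2\<close> belongs to both factors. Reading it as \<open>E(|u|\<^sup>2) (E(|w|\<^sup>2))\<^sup>1\<^sup>/\<^sup>2\<close> makes the claim on the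
  joint point spectrum false: on two points of mass \<open>1/2\<close>, with trivial \<open>F\<close>,
  \<open>u = (1/sqrt 2, 0)\<close> and \<open>w = (1/sqrt 2, sqrt (3/2))\<close>, one has
  \<open>E(uw) = E(|u|\<^sup>2) = 1/4\<close> and \<open>E(|w|\<^sup>2) = 1\<close>. Then \<open>1/4\<close> is an eigenvalue with eigenspace
  spanned by \<open>w\<close>, but the adjoint maps \<open>w\<close> to \<open>u\<close>, which is no multiple of \<open>w\<close>.\<close>

definition ennreal_sqrt :: "ennreal \<Rightarrow> ennreal" where
  "ennreal_sqrt a = (if a = \<infinity> then \<infinity> else ennreal (sqrt (enn2real a)))"

end

theory Submission
  imports Defs
begin

text \<open>Write \<open>U = E(|u|\<^sup>2)\<close>, \<open>W = E(|w|\<^sup>2)\<close>, \<open>\<phi> = E(uw)\<close>, let \<open>T\<close> be the operator \<open>f \<mapsto> w E(uf)\<close> and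
\<open>T'\<close> the operator \<open>f \<mapsto> cnj u E(cnj w f)\<close>. Over each point of the base \<open>(X, F)\<close> the operator
\<open>T\<close> has rank one, and equality in the conditional Cauchy-Schwarz inequality makes \<open>w\<close> proportional
to \<open>cnj u\<close> there, so that \<open>T\<close> is fibrewise a multiple of an orthogonal projection.

To make this precise, let \<open>G\<close> be the set where \<open>0 < U < \<infinity>\<close> and \<open>v = cnj u / sqrt U\<close> on
\<open>G\<close>, \<open>v = 0\<close> elsewhere. Then \<open>E(|v|\<^sup>2)\<close> is the indicator of \<open>G\<close>, and \<open>P f = E(cnj v f) v\<close> is an
orthogonal projection on \<open>L\<^sup>2\<close> that commutes with multiplication by functions measurable with
respect to \<open>F\<close>. The conditional Bessel identity \<open>E(|f - P f|\<^sup>2) = E(|f|\<^sup>2) - |E(cnj v f)|\<^sup>2\<close>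
(lemma \<open>bessel\<close>) bounds \<open>P\<close>. Applied to \<open>w\<close> on \<open>G\<close>, where \<open>|\<phi>|\<^sup>2 = U W\<close>, its right-hand side
vanishes, so \<open>w = P w\<close> on \<open>G\<close>. Off \<open>G\<close> one of \<open>u\<close>, \<open>w\<close> vanishes: if \<open>U = 0\<close> then \<open>u = 0\<close>, and if
\<open>U = \<infinity>\<close> then the equality forces \<open>W = 0\<close> because \<open>\<phi>\<close> is finite. This gives \<open>T f = \<phi> P f\<close> and
\<open>T' f = cnj \<phi> P f\<close> (lemmas \<open>weighted_cond_exp_eq\<close> and \<open>weighted_cond_exp_cnj_eq\<close>). In
particular \<open>\<phi>\<close> is essentially bounded on \<open>G\<close>, and \<open>T'\<close> is the adjoint of \<open>T\<close>.

The spectrum of such an operator is read off from \<open>\<phi>\<close> on \<open>G\<close>. Every set of positive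
measure in \<open>F\<close> inside \<open>G\<close> carries a unit vector in the range of \<open>P\<close>, on which \<open>T\<close> acts as
multiplication by \<open>\<phi>\<close> and \<open>T'\<close> as multiplication by \<open>cnj \<phi>\<close>. Taking level sets of \<open>\<phi>\<close> gives the
(joint) eigenvectors, and taking sets where \<open>\<phi>\<close> is close to \<open>z\<close> gives approximate eigenvectors.
Conversely, if \<open>|\<phi> - z|\<close> is bounded away from \<open>0\<close> on \<open>G\<close> and \<open>z \<noteq> 0\<close>, then
\<open>f \<mapsto> P f / (\<phi> - z) - (f - P f) / z\<close> is a bounded inverse of \<open>T - z\<close> (lemma \<open>resolvent_exists\<close>).
So the nonzero spectrum and the nonzero approximate point spectrum of \<open>T\<close> are both the nonzero
essential range of \<open>\<phi>\<close> on \<open>G\<close>, and those of \<open>T'\<close> are its complex conjugate. If \<open>z\<close> is isolated in the spectrum, \<open>\<phi>\<close> almost never takes values near \<open>z\<close>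
other than \<open>z\<close> and \<open>0\<close>. Were \<open>z\<close> not an eigenvalue, the value \<open>z\<close> would be excluded as well and
\<open>T - z\<close> would be invertible; for \<open>z = 0\<close> this uses that \<open>P\<close> is then the identity, since the range
of \<open>1 - P\<close> lies in the kernel of \<open>T\<close>.\<close>

section \<open>Conditional expectation of functions that need not be integrable\<close>

context sigma_finite_subalgebra
begin

text \<open>Since one of the positive and negative part of \<open>a\<close> vanishes at each point, pulling both out of
the defining nonnegative conditional expectations never produces a sum of two nonzero terms.
The identity therefore survives where these expectations are infinite. A typical \<open>a\<close> is
the indicator of a set in \<open>F\<close>, with \<open>g\<close> a product like \<open>uf\<close> whose conditional expectation may be infinite
off that set.\<close>

lemma real_cond_exp_mult_measurable:
  fixes a g :: "'a \<Rightarrow> real"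
  assumes [measurable]: "a \<in> borel_measurable F" "g \<in> borel_measurable M"
  shows "AE x in M. real_cond_exp M F (\<lambda>x. a x * g x) x = a x * real_cond_exp M F g x"
proof -
  have [measurable]: "a \<in> borel_measurable M"
    by (rule measurable_from_subalg[OF subalg]) fact
  define ap where "ap = (\<lambda>x. ennreal (a x))"
  define an where "an = (\<lambda>x. ennreal (- a x))"
  define gp where "gp = (\<lambda>x. ennreal (g x))"
  define gn where "gn = (\<lambda>x. ennreal (- g x))"
  have [measurable]: "ap \<in> borel_measurable F" "an \<in> borel_measurable F"
    "gp \<in> borel_measurable M" "gn \<in> borel_measurable M"
    unfolding ap_def an_def gp_def gn_def by measurable
  have [measurable]: "ap \<in> borel_measurable M" "an \<in> borel_measurable M"
    unfolding ap_def an_def by measurable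
  have pos: "(\<lambda>x. ennreal (a x * g x)) = (\<lambda>x. ap x * gp x + an x * gn x)"
  proof
    fix x show "ennreal (a x * g x) = ap x * gp x + an x * gn x"
    proof (cases "a x \<ge> 0")
      case True
      then show ?thesis unfolding ap_def an_def gp_def gn_def
        by (simp add: ennreal_mult' ennreal_neg)
    next
      case False
      then show ?thesis unfolding ap_def an_def gp_def gn_def
        using ennreal_mult'[of "- a x" "- g x"] by (simp add: ennreal_neg)
    qed
  qed
  have neg: "(\<lambda>x. ennreal (- (a x * g x))) = (\<lambda>x. ap x * gn x + an x * gp x)"
  proof
    fix x show "ennreal (- (a x * g x)) = ap x * gn x + an x * gp x"
    proof (cases "a x \<ge> 0")
      case True
      then show ?thesis unfolding ap_def an_def gp_def gn_def
        using ennreal_mult'[of "a x" "- g x"] by (simp add: ennreal_neg)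
    next
      case False
      then show ?thesis unfolding ap_def an_def gp_def gn_def
        using ennreal_mult'[of "- a x" "g x"] by (simp add: ennreal_neg)
    qed
  qed
  have "AE x in M. ap x * nn_cond_exp M F gp x = nn_cond_exp M F (\<lambda>x. ap x * gp x) x"
    "AE x in M. ap x * nn_cond_exp M F gn x = nn_cond_exp M F (\<lambda>x. ap x * gn x) x"
    "AE x in M. an x * nn_cond_exp M F gp x = nn_cond_exp M F (\<lambda>x. an x * gp x) x"
    "AE x in M. an x * nn_cond_exp M F gn x = nn_cond_exp M F (\<lambda>x. an x * gn x) x"
    by (rule nn_cond_exp_prod; measurable)+
  moreover have "AE x in M. nn_cond_exp M F (\<lambda>x. ap x * gp x) x + nn_cond_exp M F (\<lambda>x. an x * gn x) x
      = nn_cond_exp M F (\<lambda>x. ap x * gp x + an x * gn x) x"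
    "AE x in M. nn_cond_exp M F (\<lambda>x. ap x * gn x) x + nn_cond_exp M F (\<lambda>x. an x * gp x) x
      = nn_cond_exp M F (\<lambda>x. ap x * gn x + an x * gp x) x"
    by (rule nn_cond_exp_sum; measurable)+
  ultimately have "AE x in M. nn_cond_exp M F (\<lambda>x. ennreal (a x * g x)) x =
        ap x * nn_cond_exp M F gp x + an x * nn_cond_exp M F gn x \<and>
      nn_cond_exp M F (\<lambda>x. ennreal (- (a x * g x))) x =
        ap x * nn_cond_exp M F gn x + an x * nn_cond_exp M F gp x"
    unfolding pos neg by eventually_elim simp
  then show ?thesis
  proof eventually_elim
    case (elim x)
    have "a x \<ge> 0 \<or> a x \<le> 0" by linarith
    then show ?case
      unfolding real_cond_exp_def elim[THEN conjunct1] elim[THEN conjunct2]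
        gp_def[symmetric] gn_def[symmetric]
      by (auto simp: ap_def an_def ennreal_neg enn2real_mult algebra_simps)
  qed
qed

text \<open>The version of additivity appropriate to the domain of \<open>E\<close>, where the conditional expectation of
the absolute value is finite but the functions need not be integrable. Positive and negative parts
satisfy \<open>(f+g)\<^sup>+ + f\<^sup>- + g\<^sup>- = (f+g)\<^sup>- + f\<^sup>+ + g\<^sup>+\<close>; the expectation of this identity can be
rearranged because all its terms are finite.\<close>

lemma real_cond_exp_add_finite:
  fixes f g :: "'a \<Rightarrow> real"
  assumes [measurable]: "f \<in> borel_measurable M" "g \<in> borel_measurable M"
    and f: "AE x in M. nn_cond_exp M F (\<lambda>y. ennreal \<bar>f y\<bar>) x < \<infinity>"
    and g: "AE x in M. nn_cond_exp M F (\<lambda>y. ennreal \<bar>g y\<bar>) x < \<infinity>"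
  shows "AE x in M. real_cond_exp M F (\<lambda>x. f x + g x) x = real_cond_exp M F f x + real_cond_exp M F g x"
proof -
  let ?n = "nn_cond_exp M F"
  let ?p = "\<lambda>f y. ennreal (f y)" and ?m = "\<lambda>f y. ennreal (- f y)"
  let ?s = "\<lambda>y. f y + g y"
  have le: "AE x in M. ?n (?p f) x \<le> ?n (\<lambda>y. ennreal \<bar>f y\<bar>) x"
    "AE x in M. ?n (?m f) x \<le> ?n (\<lambda>y. ennreal \<bar>f y\<bar>) x"
    "AE x in M. ?n (?p g) x \<le> ?n (\<lambda>y. ennreal \<bar>g y\<bar>) x"
    "AE x in M. ?n (?m g) x \<le> ?n (\<lambda>y. ennreal \<bar>g y\<bar>) x"
    "AE x in M. ?n (?p ?s) x \<le> ?n (\<lambda>y. ennreal \<bar>f y\<bar> + ennreal \<bar>g y\<bar>) x"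
    "AE x in M. ?n (?m ?s) x \<le> ?n (\<lambda>y. ennreal \<bar>f y\<bar> + ennreal \<bar>g y\<bar>) x"
    by (intro nn_cond_exp_mono; force simp: ennreal_plus[symmetric] simp del: ennreal_plus intro!: ennreal_leI AE_I2)+
  have split: "(\<lambda>y. (?p ?s y + ?m f y) + ?m g y) = (\<lambda>y. (?m ?s y + ?p f y) + ?p g y)"
  proof
    fix y
    have *: "ennreal b + ennreal c = ennreal (max 0 b + max 0 c)" for b c :: real
      by (metis ennreal_max_0 ennreal_plus max.cobounded1)
    show "(?p ?s y + ?m f y) + ?m g y = (?m ?s y + ?p f y) + ?p g y"
      unfolding * by (rule arg_cong[of _ _ ennreal]) (simp add: max_def)
  qed
  have sum: "AE x in M. ?n (\<lambda>y. (?p ?s y + ?m f y) + ?m g y) x = ?n (?p ?s) x + ?n (?m f) x + ?n (?m g) x"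
    "AE x in M. ?n (\<lambda>y. (?m ?s y + ?p f y) + ?p g y) x = ?n (?m ?s) x + ?n (?p f) x + ?n (?p g) x"
  proof -
    have "AE x in M. ?n (?p ?s) x + ?n (?m f) x = ?n (\<lambda>y. ?p ?s y + ?m f y) x"
      "AE x in M. ?n (\<lambda>y. ?p ?s y + ?m f y) x + ?n (?m g) x = ?n (\<lambda>y. (?p ?s y + ?m f y) + ?m g y) x"
      by (rule nn_cond_exp_sum; measurable)+
    then show "AE x in M. ?n (\<lambda>y. (?p ?s y + ?m f y) + ?m g y) x = ?n (?p ?s) x + ?n (?m f) x + ?n (?m g) x"
      by eventually_elim simp
    have "AE x in M. ?n (?m ?s) x + ?n (?p f) x = ?n (\<lambda>y. ?m ?s y + ?p f y) x"
      "AE x in M. ?n (\<lambda>y. ?m ?s y + ?p f y) x + ?n (?p g) x = ?n (\<lambda>y. (?m ?s y + ?p f y) + ?p g y) x"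
      by (rule nn_cond_exp_sum; measurable)+
    then show "AE x in M. ?n (\<lambda>y. (?m ?s y + ?p f y) + ?p g y) x = ?n (?m ?s) x + ?n (?p f) x + ?n (?p g) x"
      by eventually_elim simp
  qed
  have "AE x in M. ?n (\<lambda>y. ennreal \<bar>f y\<bar>) x + ?n (\<lambda>y. ennreal \<bar>g y\<bar>) x
      = ?n (\<lambda>y. ennreal \<bar>f y\<bar> + ennreal \<bar>g y\<bar>) x"
    by (rule nn_cond_exp_sum) measurable
  with f g le sum show ?thesis
  proof eventually_elim
    case (elim x)
    have fin: "?n (?p f) x < \<infinity>" "?n (?m f) x < \<infinity>" "?n (?p g) x < \<infinity>" "?n (?m g) x < \<infinity>"
      using elim(1-6) by (auto intro: le_less_trans)
    have "?n (\<lambda>y. ennreal \<bar>f y\<bar> + ennreal \<bar>g y\<bar>) x < \<infinity>"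
      using elim(1,2,11) by (metis ennreal_add_less_top infinity_ennreal_def)
    then have fin2: "?n (?p ?s) x < \<infinity>" "?n (?m ?s) x < \<infinity>"
      using elim(7,8) by (auto intro: le_less_trans)
    have "?n (?p ?s) x + ?n (?m f) x + ?n (?m g) x = ?n (?m ?s) x + ?n (?p f) x + ?n (?p g) x"
      using elim(9,10) unfolding split by simp
    then have "enn2real (?n (?p ?s) x + ?n (?m f) x + ?n (?m g) x)
        = enn2real (?n (?m ?s) x + ?n (?p f) x + ?n (?p g) x)" by simp
    then show ?case
      unfolding real_cond_exp_def using fin fin2
      by (simp add: enn2real_plus)
  qed
qed

end

lemma borel_measurable_complex_cond_exp [measurable]:
  "complex_cond_exp M F g \<in> borel_measurable F"
  "complex_cond_exp M F g \<in> borel_measurable M"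
  unfolding complex_cond_exp_def Complex_eq by measurable

lemma complex_cond_exp_cnj:
  "complex_cond_exp M F (\<lambda>y. cnj (g y)) x = cnj (complex_cond_exp M F g x)"
  unfolding complex_cond_exp_def real_cond_exp_def by (simp add: complex_eq_iff)

lemma borel_measurable_cnj [measurable (raw)]:
  assumes "f \<in> borel_measurable M"
  shows "(\<lambda>x. cnj (f x)) \<in> borel_measurable M"
  by (rule borel_measurable_continuous_on[OF _ assms]) (intro continuous_intros)

lemma cond_exp_dom_cnj:
  assumes "g \<in> cond_exp_dom M F"
  shows "(\<lambda>y. cnj (g y)) \<in> cond_exp_dom M F"
proof -
  have [measurable]: "g \<in> borel_measurable M" using assms by (simp add: cond_exp_dom_def)
  have "(\<lambda>y. cnj (g y)) \<in> borel_measurable M" by measurable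
  then show ?thesis using assms unfolding cond_exp_dom_def by simp
qed

context sigma_finite_subalgebra
begin

lemma cond_exp_dom_bound:
  assumes [measurable]: "f \<in> borel_measurable M" "g \<in> borel_measurable M"
    and le: "AE x in M. ennreal (cmod (f x)) \<le> g x"
    and fin: "AE x in M. nn_cond_exp M F g x < \<infinity>"
  shows "f \<in> cond_exp_dom M F"
proof -
  have "AE x in M. nn_cond_exp M F (\<lambda>y. ennreal (cmod (f y))) x \<le> nn_cond_exp M F g x"
    by (rule nn_cond_exp_mono[OF le]) measurable
  with fin have "AE x in M. nn_cond_exp M F (\<lambda>y. ennreal (cmod (f y))) x < \<infinity>"
    by eventually_elim (auto intro: le_less_trans)
  then show ?thesis unfolding cond_exp_dom_def by simp
qed

lemma cond_exp_dom_add: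
  assumes "f \<in> cond_exp_dom M F" "g \<in> cond_exp_dom M F"
  shows "(\<lambda>x. f x + g x) \<in> cond_exp_dom M F"
proof -
  have [measurable]: "f \<in> borel_measurable M" "g \<in> borel_measurable M"
    using assms by (auto simp: cond_exp_dom_def)
  have "AE x in M. nn_cond_exp M F (\<lambda>y. ennreal (cmod (f y))) x + nn_cond_exp M F (\<lambda>y. ennreal (cmod (g y))) x
      = nn_cond_exp M F (\<lambda>y. ennreal (cmod (f y)) + ennreal (cmod (g y))) x"
    by (rule nn_cond_exp_sum) measurable
  moreover have "AE x in M. nn_cond_exp M F (\<lambda>y. ennreal (cmod (f y))) x < \<infinity>"
    "AE x in M. nn_cond_exp M F (\<lambda>y. ennreal (cmod (g y))) x < \<infinity>"
    using assms by (auto simp: cond_exp_dom_def)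
  ultimately have fin: "AE x in M. nn_cond_exp M F (\<lambda>y. ennreal (cmod (f y)) + ennreal (cmod (g y))) x < \<infinity>"
    by eventually_elim (metis ennreal_add_less_top infinity_ennreal_def)
  show ?thesis
  proof (rule cond_exp_dom_bound[OF _ _ _ fin])
    show "AE x in M. ennreal (cmod (f x + g x)) \<le> ennreal (cmod (f x)) + ennreal (cmod (g x))"
      by (simp add: ennreal_plus[symmetric] norm_triangle_ineq ennreal_leI del: ennreal_plus)
  qed measurable
qed

lemma cond_exp_dom_mult:
  assumes [measurable]: "a \<in> borel_measurable F" and f: "f \<in> cond_exp_dom M F"
  shows "(\<lambda>x. a x * f x) \<in> cond_exp_dom M F"
proof -
  have [measurable]: "f \<in> borel_measurable M"
    using f by (auto simp: cond_exp_dom_def)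
  have [measurable]: "a \<in> borel_measurable M"
    by (rule measurable_from_subalg[OF subalg]) fact
  have "AE x in M. ennreal (cmod (a x)) * nn_cond_exp M F (\<lambda>y. ennreal (cmod (f y))) x
      = nn_cond_exp M F (\<lambda>y. ennreal (cmod (a y)) * ennreal (cmod (f y))) x"
    by (rule nn_cond_exp_prod) measurable
  moreover have "AE x in M. nn_cond_exp M F (\<lambda>y. ennreal (cmod (f y))) x < \<infinity>"
    using f by (auto simp: cond_exp_dom_def)
  ultimately have "AE x in M. nn_cond_exp M F (\<lambda>y. ennreal (cmod (a y)) * ennreal (cmod (f y))) x < \<infinity>"
    by eventually_elim (metis ennreal_mult_less_top ennreal_less_top infinity_ennreal_def)
  then show ?thesis
    unfolding cond_exp_dom_def by (simp add: norm_mult ennreal_mult)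
qed

lemma nn_cond_exp_Re_Im_finite:
  assumes "f \<in> cond_exp_dom M F"
  shows "AE x in M. nn_cond_exp M F (\<lambda>y. ennreal \<bar>Re (f y)\<bar>) x < \<infinity>"
    and "AE x in M. nn_cond_exp M F (\<lambda>y. ennreal \<bar>Im (f y)\<bar>) x < \<infinity>"
proof -
  have [measurable]: "f \<in> borel_measurable M" using assms by (auto simp: cond_exp_dom_def)
  have fin: "AE x in M. nn_cond_exp M F (\<lambda>y. ennreal (cmod (f y))) x < \<infinity>"
    using assms by (auto simp: cond_exp_dom_def)
  have "AE x in M. nn_cond_exp M F (\<lambda>y. ennreal \<bar>Re (f y)\<bar>) x \<le> nn_cond_exp M F (\<lambda>y. ennreal (cmod (f y))) x"
    "AE x in M. nn_cond_exp M F (\<lambda>y. ennreal \<bar>Im (f y)\<bar>) x \<le> nn_cond_exp M F (\<lambda>y. ennreal (cmod (f y))) x"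
    by (intro nn_cond_exp_mono; force intro!: ennreal_leI abs_Re_le_cmod abs_Im_le_cmod AE_I2)+
  with fin show "AE x in M. nn_cond_exp M F (\<lambda>y. ennreal \<bar>Re (f y)\<bar>) x < \<infinity>"
    "AE x in M. nn_cond_exp M F (\<lambda>y. ennreal \<bar>Im (f y)\<bar>) x < \<infinity>"
    by (eventually_elim, auto intro: le_less_trans)+
qed

lemma complex_cond_exp_cong:
  assumes ae: "AE x in M. f x = g x" and [measurable]: "f \<in> borel_measurable M" "g \<in> borel_measurable M"
  shows "AE x in M. complex_cond_exp M F f x = complex_cond_exp M F g x"
proof -
  have "AE x in M. Re (f x) = Re (g x)" "AE x in M. Im (f x) = Im (g x)"
    using ae by (eventually_elim, simp)+
  then have "AE x in M. real_cond_exp M F (\<lambda>y. Re (f y)) x = real_cond_exp M F (\<lambda>y. Re (g y)) x"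
    "AE x in M. real_cond_exp M F (\<lambda>y. Im (f y)) x = real_cond_exp M F (\<lambda>y. Im (g y)) x"
    by (intro real_cond_exp_cong; measurable)+
  then show ?thesis unfolding complex_cond_exp_def by eventually_elim simp
qed

lemma complex_cond_exp_add:
  assumes "f \<in> cond_exp_dom M F" "g \<in> cond_exp_dom M F"
  shows "AE x in M. complex_cond_exp M F (\<lambda>x. f x + g x) x = complex_cond_exp M F f x + complex_cond_exp M F g x"
proof -
  have [measurable]: "f \<in> borel_measurable M" "g \<in> borel_measurable M"
    using assms by (auto simp: cond_exp_dom_def)
  have "AE x in M. real_cond_exp M F (\<lambda>x. Re (f x) + Re (g x)) x
      = real_cond_exp M F (\<lambda>x. Re (f x)) x + real_cond_exp M F (\<lambda>x. Re (g x)) x"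
    "AE x in M. real_cond_exp M F (\<lambda>x. Im (f x) + Im (g x)) x
      = real_cond_exp M F (\<lambda>x. Im (f x)) x + real_cond_exp M F (\<lambda>x. Im (g x)) x"
    by (intro real_cond_exp_add_finite nn_cond_exp_Re_Im_finite assms; measurable)+
  then show ?thesis
    unfolding complex_cond_exp_def by eventually_elim (simp add: complex_eq_iff)
qed

text \<open>For a real factor the real and imaginary parts do not mix, so nothing has to be added and \<open>f\<close> may be
any measurable function. A complex factor requires \<open>f\<close> in the domain of \<open>E\<close>.\<close>

lemma complex_cond_exp_mult_real:
  assumes [measurable]: "s \<in> borel_measurable F" "f \<in> borel_measurable M"
  shows "AE x in M. complex_cond_exp M F (\<lambda>x. complex_of_real (s x) * f x) x
    = complex_of_real (s x) * complex_cond_exp M F f x"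
proof -
  have "AE x in M. real_cond_exp M F (\<lambda>x. s x * Re (f x)) x = s x * real_cond_exp M F (\<lambda>x. Re (f x)) x"
    "AE x in M. real_cond_exp M F (\<lambda>x. s x * Im (f x)) x = s x * real_cond_exp M F (\<lambda>x. Im (f x)) x"
    by (intro real_cond_exp_mult_measurable; measurable)+
  then show ?thesis
    unfolding complex_cond_exp_def by eventually_elim (simp add: complex_eq_iff)
qed

lemma complex_cond_exp_mult:
  assumes [measurable]: "a \<in> borel_measurable F" and f: "f \<in> cond_exp_dom M F"
  shows "AE x in M. complex_cond_exp M F (\<lambda>x. a x * f x) x = a x * complex_cond_exp M F f x"
proof -
  have [measurable]: "f \<in> borel_measurable M"
    using f by (auto simp: cond_exp_dom_def)
  have [measurable]: "a \<in> borel_measurable M"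
    by (rule measurable_from_subalg[OF subalg]) fact
  let ?r = "\<lambda>x. complex_of_real (Re (a x)) * f x"
  let ?i = "\<lambda>x. complex_of_real (Im (a x)) * (\<i> * f x)"
  have if_dom: "(\<lambda>x. \<i> * f x) \<in> cond_exp_dom M F"
    by (rule cond_exp_dom_mult[OF _ f]) measurable
  have dom: "?r \<in> cond_exp_dom M F" "?i \<in> cond_exp_dom M F"
    by (intro cond_exp_dom_mult f if_dom; measurable)+
  have "(\<lambda>x. a x * f x) = (\<lambda>x. ?r x + ?i x)"
    by (auto simp: complex_eq_iff)
  then have "AE x in M. complex_cond_exp M F (\<lambda>x. a x * f x) x
      = complex_cond_exp M F ?r x + complex_cond_exp M F ?i x"
    using complex_cond_exp_add[OF dom] by simp
  moreover have "AE x in M. complex_cond_exp M F ?r x = complex_of_real (Re (a x)) * complex_cond_exp M F f x"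
    "AE x in M. complex_cond_exp M F ?i x = complex_of_real (Im (a x)) * complex_cond_exp M F (\<lambda>x. \<i> * f x) x"
    by (intro complex_cond_exp_mult_real; measurable)+
  moreover have "AE x in M. complex_cond_exp M F (\<lambda>x. \<i> * f x) x = \<i> * complex_cond_exp M F f x"
    unfolding complex_cond_exp_def real_cond_exp_def by (simp add: complex_eq_iff)
  ultimately show ?thesis
    by eventually_elim (simp add: complex_eq_iff)
qed

lemma complex_cond_exp_of_nonneg:
  fixes g :: "'a \<Rightarrow> real"
  assumes [measurable]: "g \<in> borel_measurable M" and pos: "\<And>x. g x \<ge> 0"
  shows "AE x in M. complex_cond_exp M F (\<lambda>x. complex_of_real (g x)) x
    = complex_of_real (enn2real (nn_cond_exp M F (\<lambda>x. ennreal (g x)) x))"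
proof -
  have "(\<lambda>x. ennreal (- g x)) = (\<lambda>x. 0)" using pos by (auto simp: ennreal_neg)
  moreover have "AE x in M. 0 = nn_cond_exp M F (\<lambda>x. 0) x"
    by (rule nn_cond_exp_F_meas) measurable
  ultimately show ?thesis
    unfolding complex_cond_exp_def real_cond_exp_def by (auto simp: complex_eq_iff)
qed

lemma complex_cond_exp_integral:
  assumes "integrable M f"
  shows "integrable M (complex_cond_exp M F f)"
    and "(\<integral>x. complex_cond_exp M F f x \<partial>M) = (\<integral>x. f x \<partial>M)"
proof -
  have i: "integrable M (\<lambda>x. Re (f x))" "integrable M (\<lambda>x. Im (f x))" using assms by auto
  note r = real_cond_exp_int[OF i(1)] and m = real_cond_exp_int[OF i(2)]
  show int: "integrable M (complex_cond_exp M F f)"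
    unfolding complex_cond_exp_def Complex_eq using r(1) m(1) by auto
  have "Re (\<integral>x. complex_cond_exp M F f x \<partial>M) = Re (\<integral>x. f x \<partial>M)"
    unfolding integral_Re[OF int, symmetric] integral_Re[OF assms, symmetric]
    using r(2) by (simp add: complex_cond_exp_def)
  moreover have "Im (\<integral>x. complex_cond_exp M F f x \<partial>M) = Im (\<integral>x. f x \<partial>M)"
    unfolding integral_Im[OF int, symmetric] integral_Im[OF assms, symmetric]
    using m(2) by (simp add: complex_cond_exp_def)
  ultimately show "(\<integral>x. complex_cond_exp M F f x \<partial>M) = (\<integral>x. f x \<partial>M)"
    by (simp add: complex_eq_iff)
qed

text \<open>The integral of \<open>|f|\<^sup>2\<close> over the set where its conditional expectation vanishes is \<open>0\<close>, as that set
belongs to \<open>F\<close>.\<close>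

lemma AE_eq_0_of_nn_cond_exp_eq_0:
  assumes [measurable]: "f \<in> borel_measurable M"
  shows "AE x in M. nn_cond_exp M F (\<lambda>y. ennreal ((cmod (f y))\<^sup>2)) x = 0 \<longrightarrow> f x = 0"
proof -
  let ?n = "nn_cond_exp M F (\<lambda>y. ennreal ((cmod (f y))\<^sup>2))"
  let ?i = "\<lambda>x. indicator {0} (?n x) :: ennreal"
  have "(\<integral>\<^sup>+x. ?i x * ennreal ((cmod (f x))\<^sup>2) \<partial>M) = (\<integral>\<^sup>+x. ?i x * ?n x \<partial>M)"
    by (rule nn_cond_exp_intg[symmetric]) measurable
  also have "(\<lambda>x. ?i x * ?n x) = (\<lambda>_. 0)" by (auto simp: indicator_def)
  also have "(\<integral>\<^sup>+x. 0 \<partial>M) = 0" by simp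
  finally have "AE x in M. ?i x * ennreal ((cmod (f x))\<^sup>2) = 0"
    by (subst (asm) nn_integral_0_iff_AE) measurable
  then show ?thesis by eventually_elim (auto simp: indicator_def)
qed

text \<open>Conditional expectation is local on sets in \<open>F\<close>, also for functions outside the domain of \<open>E\<close>.
This controls \<open>E(uf)\<close> and \<open>E(wf)\<close> on the sets where the weights are well behaved, whatever their
values elsewhere.\<close>

lemma complex_cond_exp_cong_on:
  assumes A: "A \<in> sets F" and [measurable]: "f \<in> borel_measurable M" "g \<in> borel_measurable M"
    and eq: "AE x in M. x \<in> A \<longrightarrow> f x = g x"
  shows "AE x in M. x \<in> A \<longrightarrow> complex_cond_exp M F f x = complex_cond_exp M F g x"
proof -
  have [measurable]: "A \<in> sets F" "A \<in> sets M" using A subalg unfolding subalgebra_def by auto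
  let ?i = "\<lambda>x. complex_of_real (indicator A x)"
  have "AE x in M. ?i x * f x = ?i x * g x"
    using eq by eventually_elim (simp add: indicator_def)
  then have "AE x in M. complex_cond_exp M F (\<lambda>x. ?i x * f x) x = complex_cond_exp M F (\<lambda>x. ?i x * g x) x"
    by (rule complex_cond_exp_cong) measurable
  moreover have "AE x in M. complex_cond_exp M F (\<lambda>x. ?i x * f x) x = ?i x * complex_cond_exp M F f x"
    "AE x in M. complex_cond_exp M F (\<lambda>x. ?i x * g x) x = ?i x * complex_cond_exp M F g x"
    by (intro complex_cond_exp_mult_real; measurable)+
  ultimately show ?thesis by eventually_elim auto
qed

lemma complex_cond_exp_eq_0_on:
  assumes "A \<in> sets F" "f \<in> borel_measurable M" "AE x in M. x \<in> A \<longrightarrow> f x = 0"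
  shows "AE x in M. x \<in> A \<longrightarrow> complex_cond_exp M F f x = 0"
proof -
  have "complex_cond_exp M F (\<lambda>_. 0) x = 0" for x
    by (simp add: complex_cond_exp_def real_cond_exp_def complex_eq_iff)
  then show ?thesis
    using complex_cond_exp_cong_on[OF assms(1,2) borel_measurable_const assms(3)] by simp
qed

end

section \<open>The space of square integrable functions\<close>

lemma L2_spaceD:
  assumes "f \<in> L2_space M"
  shows "f \<in> borel_measurable M" "integrable M (\<lambda>x. (cmod (f x))\<^sup>2)"
  using assms by (auto simp: L2_space_def)

lemma L2_norm_nonneg: "0 \<le> L2_norm M f"
  unfolding L2_norm_def by simp

lemma L2_norm_power2: "(L2_norm M f)\<^sup>2 = (\<integral>x. (cmod (f x))\<^sup>2 \<partial>M)"
  unfolding L2_norm_def by simp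

lemma L2_norm_power2_ennreal:
  assumes "f \<in> L2_space M"
  shows "ennreal ((L2_norm M f)\<^sup>2) = (\<integral>\<^sup>+x. ennreal ((cmod (f x))\<^sup>2) \<partial>M)"
  unfolding L2_norm_power2 using L2_spaceD(2)[OF assms] by (simp add: nn_integral_eq_integral)

lemma L2_spaceI:
  assumes [measurable]: "f \<in> borel_measurable M"
    and "(\<integral>\<^sup>+x. ennreal ((cmod (f x))\<^sup>2) \<partial>M) < \<infinity>"
  shows "f \<in> L2_space M"
  unfolding L2_space_def using assms by (auto intro!: integrableI_bounded)

text \<open>Membership in \<open>L\<^sup>2\<close> and the norm estimate come out of the same comparison of nonnegative
integrals.\<close>

lemma L2_norm_le:
  assumes f: "f \<in> borel_measurable M" and g: "g \<in> L2_space M" and "0 \<le> C"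
    and le: "(\<integral>\<^sup>+x. ennreal ((cmod (f x))\<^sup>2) \<partial>M) \<le> ennreal (C\<^sup>2) * (\<integral>\<^sup>+x. ennreal ((cmod (g x))\<^sup>2) \<partial>M)"
  shows "f \<in> L2_space M" "L2_norm M f \<le> C * L2_norm M g"
proof -
  have eq: "ennreal (C\<^sup>2) * (\<integral>\<^sup>+x. ennreal ((cmod (g x))\<^sup>2) \<partial>M) = ennreal ((C * L2_norm M g)\<^sup>2)"
    unfolding L2_norm_power2_ennreal[OF g, symmetric] by (simp add: ennreal_mult power_mult_distrib)
  show f2: "f \<in> L2_space M"
    by (rule L2_spaceI[OF f]) (use le in \<open>auto simp: eq intro: le_less_trans\<close>)
  have "ennreal ((L2_norm M f)\<^sup>2) \<le> ennreal ((C * L2_norm M g)\<^sup>2)"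
    using le unfolding eq L2_norm_power2_ennreal[OF f2] .
  then have "(L2_norm M f)\<^sup>2 \<le> (C * L2_norm M g)\<^sup>2" by simp
  then show "L2_norm M f \<le> C * L2_norm M g"
    by (rule power2_le_imp_le) (simp add: \<open>0 \<le> C\<close> L2_norm_nonneg)
qed

lemma L2_mult_bounded:
  assumes g: "g \<in> L2_space M" and [measurable]: "a \<in> borel_measurable M" and "0 \<le> C"
    and a: "AE x in M. g x \<noteq> 0 \<longrightarrow> cmod (a x) \<le> C"
  shows "(\<lambda>x. a x * g x) \<in> L2_space M" "L2_norm M (\<lambda>x. a x * g x) \<le> C * L2_norm M g"
proof -
  have [measurable]: "g \<in> borel_measurable M" using L2_spaceD[OF g] by simp
  have "(\<integral>\<^sup>+x. ennreal ((cmod (a x * g x))\<^sup>2) \<partial>M) \<le> (\<integral>\<^sup>+x. ennreal (C\<^sup>2) * ennreal ((cmod (g x))\<^sup>2) \<partial>M)"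
  proof (rule nn_integral_mono_AE)
    show "AE x in M. ennreal ((cmod (a x * g x))\<^sup>2) \<le> ennreal (C\<^sup>2) * ennreal ((cmod (g x))\<^sup>2)"
      using a
    proof eventually_elim
      case (elim x)
      show ?case
      proof (cases "g x = 0")
        case False
        then have "(cmod (a x))\<^sup>2 \<le> C\<^sup>2" using elim by (simp add: power_mono)
        then have "(cmod (a x * g x))\<^sup>2 \<le> C\<^sup>2 * (cmod (g x))\<^sup>2"
          by (simp add: norm_mult power_mult_distrib mult_right_mono)
        then show ?thesis by (simp add: ennreal_mult[symmetric])
      qed simp
    qed
  qed
  also have "\<dots> = ennreal (C\<^sup>2) * (\<integral>\<^sup>+x. ennreal ((cmod (g x))\<^sup>2) \<partial>M)"
    by (rule nn_integral_cmult) measurable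
  finally have le: "(\<integral>\<^sup>+x. ennreal ((cmod (a x * g x))\<^sup>2) \<partial>M)
      \<le> ennreal (C\<^sup>2) * (\<integral>\<^sup>+x. ennreal ((cmod (g x))\<^sup>2) \<partial>M)" .
  show "(\<lambda>x. a x * g x) \<in> L2_space M" "L2_norm M (\<lambda>x. a x * g x) \<le> C * L2_norm M g"
    by (rule L2_norm_le[OF _ g \<open>0 \<le> C\<close> le]; measurable)+
qed

lemma L2_scale: "g \<in> L2_space M \<Longrightarrow> (\<lambda>x. c * g x) \<in> L2_space M"
  using L2_mult_bounded(1)[of g M "\<lambda>_. c" "cmod c"] by simp

lemma L2_norm_scale: "L2_norm M (\<lambda>x. c * g x) = cmod c * L2_norm M g"
  unfolding L2_norm_def by (simp add: norm_mult power_mult_distrib real_sqrt_mult)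

text \<open>A cheap substitute for the triangle inequality: constants are irrelevant for the boundedness of
operators.\<close>

lemma cmod_add_power2_le: "(cmod (a + b))\<^sup>2 \<le> 2 * (cmod a)\<^sup>2 + 2 * (cmod b)\<^sup>2"
proof -
  have "(cmod (a + b))\<^sup>2 \<le> (cmod a + cmod b)\<^sup>2" by (simp add: power_mono norm_triangle_ineq)
  also have "\<dots> \<le> 2 * (cmod a)\<^sup>2 + 2 * (cmod b)\<^sup>2"
    using sum_squares_bound[of "cmod a" "cmod b"] by (simp add: power2_sum)
  finally show ?thesis .
qed

lemma L2_add:
  assumes "f \<in> L2_space M" "g \<in> L2_space M"
  shows "(\<lambda>x. f x + g x) \<in> L2_space M"
    and "(L2_norm M (\<lambda>x. f x + g x))\<^sup>2 \<le> 2 * (L2_norm M f)\<^sup>2 + 2 * (L2_norm M g)\<^sup>2"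
proof -
  note [measurable] = L2_spaceD(1)[OF assms(1)] L2_spaceD(1)[OF assms(2)]
  have int: "integrable M (\<lambda>x. 2 * (cmod (f x))\<^sup>2 + 2 * (cmod (g x))\<^sup>2)"
    using assms[THEN L2_spaceD(2)] by auto
  have int': "integrable M (\<lambda>x. (cmod (f x + g x))\<^sup>2)"
    by (rule Bochner_Integration.integrable_bound[OF int]) (auto intro!: cmod_add_power2_le)
  then show "(\<lambda>x. f x + g x) \<in> L2_space M" unfolding L2_space_def by simp
  have "(L2_norm M (\<lambda>x. f x + g x))\<^sup>2 \<le> (\<integral>x. 2 * (cmod (f x))\<^sup>2 + 2 * (cmod (g x))\<^sup>2 \<partial>M)"
    unfolding L2_norm_power2 by (rule integral_mono[OF int' int]) (rule cmod_add_power2_le)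
  also have "\<dots> = 2 * (L2_norm M f)\<^sup>2 + 2 * (L2_norm M g)\<^sup>2"
    using assms[THEN L2_spaceD(2)] by (simp add: L2_norm_power2)
  finally show "(L2_norm M (\<lambda>x. f x + g x))\<^sup>2 \<le> 2 * (L2_norm M f)\<^sup>2 + 2 * (L2_norm M g)\<^sup>2" .
qed

lemma L2_diff:
  assumes "f \<in> L2_space M" "g \<in> L2_space M"
  shows "(\<lambda>x. f x - g x) \<in> L2_space M"
proof -
  have "(\<lambda>x. f x + (- 1) * g x) \<in> L2_space M"
    by (intro L2_add(1) L2_scale assms)
  then show ?thesis by simp
qed

lemma L2_cong:
  assumes "f \<in> L2_space M" "AE x in M. f x = g x" "g \<in> borel_measurable M"
  shows "g \<in> L2_space M"
proof -
  have "integrable M (\<lambda>x. (cmod (f x))\<^sup>2)" by (rule L2_spaceD(2)[OF assms(1)])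
  moreover have "(\<lambda>x. (cmod (g x))\<^sup>2) \<in> borel_measurable M" using assms(3) by auto
  moreover have "AE x in M. (cmod (f x))\<^sup>2 = (cmod (g x))\<^sup>2"
    using assms(2) by eventually_elim simp
  ultimately have "integrable M (\<lambda>x. (cmod (g x))\<^sup>2)"
    by (rule integrable_cong_AE_imp)
  with assms(3) show ?thesis unfolding L2_space_def by simp
qed

lemma L2_norm_cong:
  assumes "AE x in M. f x = g x" "f \<in> borel_measurable M" "g \<in> borel_measurable M"
  shows "L2_norm M f = L2_norm M g"
proof -
  have "AE x in M. (cmod (f x))\<^sup>2 = (cmod (g x))\<^sup>2" using assms(1) by eventually_elim simp
  then show ?thesis unfolding L2_norm_def using assms(2,3)
    by (intro arg_cong[of _ _ sqrt] integral_cong_AE) auto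
qed

lemma L2_norm_eq_0_iff:
  assumes "f \<in> L2_space M"
  shows "L2_norm M f = 0 \<longleftrightarrow> (AE x in M. f x = 0)"
  using integral_nonneg_eq_0_iff_AE[OF L2_spaceD(2)[OF assms]]
  by (simp add: L2_norm_def)

lemma L2_normalize:
  assumes "f \<in> L2_space M" "\<not> (AE x in M. f x = 0)"
  obtains c where "c \<noteq> 0" "L2_norm M (\<lambda>x. c * f x) = 1"
proof
  have n: "L2_norm M f \<noteq> 0" using assms L2_norm_eq_0_iff by blast
  then show "complex_of_real (1 / L2_norm M f) \<noteq> 0" by simp
  show "L2_norm M (\<lambda>x. complex_of_real (1 / L2_norm M f) * f x) = 1"
    unfolding L2_norm_scale norm_of_real using n L2_norm_nonneg[of M f] by simp
qed

lemma L2_mult_integrable: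
  assumes "f \<in> L2_space M" "g \<in> L2_space M"
  shows "integrable M (\<lambda>x. f x * g x)"
proof -
  note [measurable] = L2_spaceD(1)[OF assms(1)] L2_spaceD(1)[OF assms(2)]
  have int: "integrable M (\<lambda>x. (cmod (f x))\<^sup>2 + (cmod (g x))\<^sup>2)"
    using assms[THEN L2_spaceD(2)] by auto
  show ?thesis
  proof (rule Bochner_Integration.integrable_bound[OF int])
    show "AE x in M. norm (f x * g x) \<le> norm ((cmod (f x))\<^sup>2 + (cmod (g x))\<^sup>2)"
    proof (rule AE_I2)
      fix x
      have "cmod (f x) * cmod (g x) \<le> (cmod (f x))\<^sup>2 + (cmod (g x))\<^sup>2"
        using sum_squares_bound[of "cmod (f x)" "cmod (g x)"]
          mult_nonneg_nonneg[OF norm_ge_zero[of "f x"] norm_ge_zero[of "g x"]] by linarith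
      then show "norm (f x * g x) \<le> norm ((cmod (f x))\<^sup>2 + (cmod (g x))\<^sup>2)"
        by (simp add: norm_mult)
    qed
  qed measurable
qed

lemma L2_cnj: "f \<in> L2_space M \<Longrightarrow> (\<lambda>x. cnj (f x)) \<in> L2_space M"
  unfolding L2_space_def by auto

section \<open>Conditionally square integrable functions\<close>

text \<open>Weights such as \<open>w\<close> and products \<open>a v\<close> with \<open>a\<close> measurable with respect to \<open>F\<close> are square integrable only
conditionally on \<open>F\<close>. This space contains \<open>L\<^sup>2\<close> and is a module over all
\<open>F\<close>-measurable functions, bounded or not.\<close>

definition cond_L2 :: "'a measure \<Rightarrow> 'a measure \<Rightarrow> ('a \<Rightarrow> complex) set" where
  "cond_L2 M F =
     {f \<in> borel_measurable M. AE x in M. nn_cond_exp M F (\<lambda>y. ennreal ((cmod (f y))\<^sup>2)) x < \<infinity>}"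

context sigma_finite_subalgebra
begin

lemma L2_imp_cond_L2:
  assumes "f \<in> L2_space M"
  shows "f \<in> cond_L2 M F"
proof -
  note [measurable] = L2_spaceD(1)[OF assms]
  let ?n = "nn_cond_exp M F (\<lambda>y. ennreal ((cmod (f y))\<^sup>2))"
  have "(\<integral>\<^sup>+x. ?n x \<partial>M) = (\<integral>\<^sup>+x. ennreal ((cmod (f x))\<^sup>2) \<partial>M)"
    using nn_cond_exp_intg[of "\<lambda>_. 1" "\<lambda>y. ennreal ((cmod (f y))\<^sup>2)"] by simp
  then have "(\<integral>\<^sup>+x. ?n x \<partial>M) \<noteq> \<infinity>"
    unfolding L2_norm_power2_ennreal[OF assms, symmetric] by simp
  then have "AE x in M. ?n x \<noteq> \<infinity>"
    by (intro nn_integral_noteq_infinite) measurable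
  then show ?thesis unfolding cond_L2_def by (simp add: less_top)
qed

lemma cond_L2_mult_dom:
  assumes "f \<in> cond_L2 M F" "g \<in> cond_L2 M F"
  shows "(\<lambda>x. f x * g x) \<in> cond_exp_dom M F"
proof -
  have [measurable]: "f \<in> borel_measurable M" "g \<in> borel_measurable M"
    using assms by (auto simp: cond_L2_def)
  let ?f = "\<lambda>y. ennreal ((cmod (f y))\<^sup>2)" and ?g = "\<lambda>y. ennreal ((cmod (g y))\<^sup>2)"
  have "AE x in M. nn_cond_exp M F ?f x + nn_cond_exp M F ?g x = nn_cond_exp M F (\<lambda>y. ?f y + ?g y) x"
    by (rule nn_cond_exp_sum) measurable
  moreover have "AE x in M. nn_cond_exp M F ?f x < \<infinity>" "AE x in M. nn_cond_exp M F ?g x < \<infinity>"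
    using assms by (auto simp: cond_L2_def)
  ultimately have fin: "AE x in M. nn_cond_exp M F (\<lambda>y. ?f y + ?g y) x < \<infinity>"
    by eventually_elim (metis ennreal_add_less_top infinity_ennreal_def)
  show ?thesis
  proof (rule cond_exp_dom_bound[OF _ _ _ fin])
    show "AE x in M. ennreal (cmod (f x * g x)) \<le> ?f x + ?g x"
    proof (rule AE_I2)
      fix x
      have "cmod (f x) * cmod (g x) \<le> (cmod (f x))\<^sup>2 + (cmod (g x))\<^sup>2"
        using sum_squares_bound[of "cmod (f x)" "cmod (g x)"]
          mult_nonneg_nonneg[OF norm_ge_zero[of "f x"] norm_ge_zero[of "g x"]] by linarith
      then show "ennreal (cmod (f x * g x)) \<le> ?f x + ?g x"
        by (simp add: ennreal_plus[symmetric] norm_mult ennreal_leI del: ennreal_plus)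
    qed
  qed measurable
qed

lemma cond_L2_cnj: "f \<in> cond_L2 M F \<Longrightarrow> (\<lambda>x. cnj (f x)) \<in> cond_L2 M F"
  unfolding cond_L2_def by auto

lemma cond_L2_mult:
  assumes [measurable]: "a \<in> borel_measurable F" and f: "f \<in> cond_L2 M F"
  shows "(\<lambda>x. a x * f x) \<in> cond_L2 M F"
proof -
  have [measurable]: "f \<in> borel_measurable M" using f by (auto simp: cond_L2_def)
  have [measurable]: "a \<in> borel_measurable M"
    by (rule measurable_from_subalg[OF subalg]) fact
  have "AE x in M. ennreal ((cmod (a x))\<^sup>2) * nn_cond_exp M F (\<lambda>y. ennreal ((cmod (f y))\<^sup>2)) x
      = nn_cond_exp M F (\<lambda>y. ennreal ((cmod (a y))\<^sup>2) * ennreal ((cmod (f y))\<^sup>2)) x"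
    by (rule nn_cond_exp_prod) measurable
  moreover have "AE x in M. nn_cond_exp M F (\<lambda>y. ennreal ((cmod (f y))\<^sup>2)) x < \<infinity>"
    using f by (auto simp: cond_L2_def)
  ultimately have "AE x in M. nn_cond_exp M F (\<lambda>y. ennreal ((cmod (a y))\<^sup>2) * ennreal ((cmod (f y))\<^sup>2)) x < \<infinity>"
    by eventually_elim (metis ennreal_mult_less_top ennreal_less_top infinity_ennreal_def)
  then show ?thesis
    unfolding cond_L2_def by (simp add: norm_mult ennreal_mult power_mult_distrib)
qed

lemma cond_L2_add:
  assumes f: "f \<in> cond_L2 M F" and g: "g \<in> cond_L2 M F"
  shows "(\<lambda>x. f x + g x) \<in> cond_L2 M F"
proof -
  have [measurable]: "f \<in> borel_measurable M" "g \<in> borel_measurable M"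
    using assms by (auto simp: cond_L2_def)
  let ?s = "\<lambda>x. f x + g x"
  have dom: "(\<lambda>x. ?s x * cnj (?s x)) \<in> cond_exp_dom M F"
  proof -
    have "(\<lambda>x. (f x * cnj (f x) + f x * cnj (g x)) + (g x * cnj (f x) + g x * cnj (g x))) \<in> cond_exp_dom M F"
      by (intro cond_exp_dom_add cond_L2_mult_dom cond_L2_cnj f g)
    then show ?thesis by (simp add: algebra_simps)
  qed
  then show ?thesis
    unfolding cond_L2_def cond_exp_dom_def by (simp add: norm_mult power2_eq_square del: complex_cnj_add)
qed

end

section \<open>The projection defined by a conditional unit vector\<close>

text \<open>A function \<open>v\<close> of conditional norm \<open>1\<close> over \<open>G\<close> and \<open>0\<close> elsewhere. Conditionally on \<open>F\<close> it spans a
line over \<open>G\<close>; \<open>coeff f\<close> is the conditional inner product of \<open>f\<close> with \<open>v\<close>, and \<open>proj\<close> is the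
orthogonal projection onto the line.\<close>

locale conditional_unit_vector = sigma_finite_subalgebra M F for M F :: "'a measure" +
  fixes v :: "'a \<Rightarrow> complex" and G :: "'a set"
  assumes v_measurable [measurable]: "v \<in> borel_measurable M"
    and G_sets [measurable]: "G \<in> sets F"
    and v_eq_0: "x \<notin> G \<Longrightarrow> v x = 0"
    and v_unit: "AE x in M. nn_cond_exp M F (\<lambda>y. ennreal ((cmod (v y))\<^sup>2)) x = indicator G x"
begin

definition coeff :: "('a \<Rightarrow> complex) \<Rightarrow> 'a \<Rightarrow> complex" where
  "coeff f = complex_cond_exp M F (\<lambda>y. cnj (v y) * f y)"

definition proj :: "('a \<Rightarrow> complex) \<Rightarrow> 'a \<Rightarrow> complex" where
  "proj f x = coeff f x * v x"

lemma coeff_measurable [measurable]: "coeff f \<in> borel_measurable F" "coeff f \<in> borel_measurable M"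
  unfolding coeff_def by measurable

lemma G_sets_M [measurable]: "G \<in> sets M"
  using subalg G_sets unfolding subalgebra_def by auto

lemma proj_measurable [measurable]: "proj f \<in> borel_measurable M"
  unfolding proj_def[abs_def] by measurable

lemma v_cond_L2: "v \<in> cond_L2 M F"
proof -
  have "AE x in M. nn_cond_exp M F (\<lambda>y. ennreal ((cmod (v y))\<^sup>2)) x < \<infinity>"
    using v_unit by eventually_elim (simp add: indicator_def)
  then show ?thesis unfolding cond_L2_def by simp
qed

lemma coeff_dom: "f \<in> cond_L2 M F \<Longrightarrow> (\<lambda>y. cnj (v y) * f y) \<in> cond_exp_dom M F"
  by (intro cond_L2_mult_dom cond_L2_cnj v_cond_L2)

lemma coeff_cong:
  assumes ae: "AE x in M. f x = g x" and [measurable]: "f \<in> borel_measurable M" "g \<in> borel_measurable M"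
  shows "AE x in M. coeff f x = coeff g x"
  unfolding coeff_def by (rule complex_cond_exp_cong) (use ae in \<open>auto\<close>)

lemma coeff_add:
  assumes "f \<in> cond_L2 M F" "g \<in> cond_L2 M F"
  shows "AE x in M. coeff (\<lambda>y. f y + g y) x = coeff f x + coeff g x"
  using complex_cond_exp_add[OF coeff_dom[OF assms(1)] coeff_dom[OF assms(2)]]
  unfolding coeff_def by (simp add: distrib_left)

lemma coeff_mult:
  assumes "a \<in> borel_measurable F" "f \<in> cond_L2 M F"
  shows "AE x in M. coeff (\<lambda>y. a y * f y) x = a x * coeff f x"
  using complex_cond_exp_mult[OF assms(1) coeff_dom[OF assms(2)]]
  unfolding coeff_def by (simp add: mult.left_commute)

lemma complex_cond_exp_v: "AE x in M. complex_cond_exp M F (\<lambda>y. cnj (v y) * v y) x = indicator G x"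
proof -
  have *: "cnj (v y) * v y = complex_of_real ((cmod (v y))\<^sup>2)" for y
    by (simp only: complex_norm_square) (rule mult.commute)
  have "AE x in M. complex_cond_exp M F (\<lambda>y. complex_of_real ((cmod (v y))\<^sup>2)) x
      = complex_of_real (enn2real (nn_cond_exp M F (\<lambda>y. ennreal ((cmod (v y))\<^sup>2)) x))"
    by (rule complex_cond_exp_of_nonneg) auto
  with v_unit show ?thesis unfolding * by eventually_elim (simp add: indicator_def)
qed

lemma coeff_mult_v:
  assumes "a \<in> borel_measurable F"
  shows "AE x in M. coeff (\<lambda>y. a y * v y) x = a x * indicator G x"
  using coeff_mult[OF assms v_cond_L2] complex_cond_exp_v
  unfolding coeff_def by eventually_elim simp

lemma compl_G_sets: "space M - G \<in> sets F"
  using subalg sets.compl_sets[OF G_sets] unfolding subalgebra_def by simp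

lemma coeff_eq_0:
  assumes [measurable]: "f \<in> borel_measurable M"
  shows "AE x in M. x \<notin> G \<longrightarrow> coeff f x = 0"
proof -
  have "AE x in M. x \<in> space M - G \<longrightarrow> coeff f x = 0"
    unfolding coeff_def
  proof (rule complex_cond_exp_eq_0_on[OF compl_G_sets])
    show "AE x in M. x \<in> space M - G \<longrightarrow> cnj (v x) * f x = 0"
      by (rule AE_I2) (simp add: v_eq_0)
  qed measurable
  with AE_space show ?thesis by eventually_elim simp
qed

lemma proj_eq_0: "x \<notin> G \<Longrightarrow> proj f x = 0"
  unfolding proj_def by (simp add: v_eq_0)

lemma coeff_proj:
  assumes "f \<in> borel_measurable M"
  shows "AE x in M. coeff (proj f) x = coeff f x"
proof -
  have "AE x in M. coeff (proj f) x = coeff f x * indicator G x"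
    using coeff_mult_v[of "coeff f"] unfolding proj_def[abs_def] by simp
  with coeff_eq_0[OF assms] show ?thesis
    by eventually_elim (auto simp: indicator_def)
qed

lemma proj_cond_L2: "proj f \<in> cond_L2 M F"
  unfolding proj_def[abs_def] by (rule cond_L2_mult[OF _ v_cond_L2]) measurable

lemma proj_cong:
  assumes "AE x in M. f x = g x" "f \<in> borel_measurable M" "g \<in> borel_measurable M"
  shows "AE x in M. proj f x = proj g x"
  using coeff_cong[OF assms] unfolding proj_def by eventually_elim simp

lemma proj_mult:
  assumes "a \<in> borel_measurable F" "f \<in> cond_L2 M F"
  shows "AE x in M. proj (\<lambda>y. a y * f y) x = a x * proj f x"
  using coeff_mult[OF assms] unfolding proj_def by eventually_elim simp

lemma proj_add:
  assumes "f \<in> cond_L2 M F" "g \<in> cond_L2 M F"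
  shows "AE x in M. proj (\<lambda>y. f y + g y) x = proj f x + proj g x"
  using coeff_add[OF assms] unfolding proj_def by eventually_elim (simp add: distrib_right)

lemma proj_proj:
  assumes "f \<in> borel_measurable M"
  shows "AE x in M. proj (proj f) x = proj f x"
  using coeff_proj[OF assms] unfolding proj_def[of "proj f"] proj_def[of f]
  by eventually_elim simp

text \<open>Expand the square in \<open>|f - h v|\<^sup>2\<close> with \<open>h = E(cnj v f)\<close> and take out the \<open>F\<close>-measurable
coefficients \<open>h\<close>: both cross terms contribute \<open>-|h|\<^sup>2\<close>, and the last term \<open>|h|\<^sup>2 E(|v|\<^sup>2)\<close> is \<open>|h|\<^sup>2\<close>
since \<open>h\<close> vanishes off \<open>G\<close>.\<close>

lemma bessel:
  assumes f: "f \<in> cond_L2 M F"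
  shows "AE x in M. enn2real (nn_cond_exp M F (\<lambda>y. ennreal ((cmod (f y - proj f y))\<^sup>2)) x)
    = enn2real (nn_cond_exp M F (\<lambda>y. ennreal ((cmod (f y))\<^sup>2)) x) - (cmod (coeff f x))\<^sup>2"
proof -
  have [measurable]: "f \<in> borel_measurable M" using f by (simp add: cond_L2_def)
  let ?E = "complex_cond_exp M F" and ?h = "coeff f"
  let ?t1 = "\<lambda>y. complex_of_real ((cmod (f y))\<^sup>2)"
  let ?t2 = "\<lambda>y. (- cnj (?h y)) * (cnj (v y) * f y)"
  let ?t3 = "\<lambda>y. (- ?h y) * cnj (cnj (v y) * f y)"
  let ?t4 = "\<lambda>y. (?h y * cnj (?h y)) * (cnj (v y) * v y)"
  have sq: "complex_of_real ((cmod z)\<^sup>2) = z * cnj z" for z by (rule complex_norm_square)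
  have eq: "(\<lambda>y. complex_of_real ((cmod (f y - proj f y))\<^sup>2)) = (\<lambda>y. (?t1 y + ?t2 y) + (?t3 y + ?t4 y))"
    unfolding sq proj_def by (simp add: algebra_simps)
  have dom0: "?t1 \<in> cond_exp_dom M F" unfolding sq by (intro cond_L2_mult_dom cond_L2_cnj f)
  note dv = coeff_dom[OF f] coeff_dom[OF v_cond_L2] cond_exp_dom_cnj[OF coeff_dom[OF f]]
  have dom: "?t2 \<in> cond_exp_dom M F" "?t3 \<in> cond_exp_dom M F" "?t4 \<in> cond_exp_dom M F"
    by (intro cond_exp_dom_mult dv; measurable)+
  have "AE x in M. ?E ?t2 x = (- cnj (?h x)) * ?E (\<lambda>y. cnj (v y) * f y) x"
    "AE x in M. ?E ?t3 x = (- ?h x) * ?E (\<lambda>y. cnj (cnj (v y) * f y)) x"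
    "AE x in M. ?E ?t4 x = (?h x * cnj (?h x)) * ?E (\<lambda>y. cnj (v y) * v y) x"
    by (intro complex_cond_exp_mult dv; measurable)+
  moreover have "AE x in M. ?E (\<lambda>y. ?t1 y + ?t2 y) x = ?E ?t1 x + ?E ?t2 x"
    "AE x in M. ?E (\<lambda>y. ?t3 y + ?t4 y) x = ?E ?t3 x + ?E ?t4 x"
    "AE x in M. ?E (\<lambda>y. (?t1 y + ?t2 y) + (?t3 y + ?t4 y)) x
      = ?E (\<lambda>y. ?t1 y + ?t2 y) x + ?E (\<lambda>y. ?t3 y + ?t4 y) x"
    by (intro complex_cond_exp_add cond_exp_dom_add dom0 dom)+
  moreover have "AE x in M. ?E ?t1 x = complex_of_real (enn2real (nn_cond_exp M F (\<lambda>y. ennreal ((cmod (f y))\<^sup>2)) x))"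
    "AE x in M. ?E (\<lambda>y. complex_of_real ((cmod (f y - proj f y))\<^sup>2)) x
      = complex_of_real (enn2real (nn_cond_exp M F (\<lambda>y. ennreal ((cmod (f y - proj f y))\<^sup>2)) x))"
    by (intro complex_cond_exp_of_nonneg; simp)+
  moreover note complex_cond_exp_v coeff_eq_0[OF \<open>f \<in> borel_measurable M\<close>]
  ultimately show ?thesis
  proof eventually_elim
    case (elim x)
    have h: "?E (\<lambda>y. cnj (v y) * f y) x = ?h x" "?E (\<lambda>y. cnj (cnj (v y) * f y)) x = cnj (?h x)"
      unfolding coeff_def by (rule refl, rule complex_cond_exp_cnj)
    let ?N = "\<lambda>g. enn2real (nn_cond_exp M F (\<lambda>y. ennreal ((cmod (g y))\<^sup>2)) x)"
    have hG: "?h x * indicator G x = ?h x" using elim(10) by (auto simp: indicator_def)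
    have "complex_of_real (?N (\<lambda>y. f y - proj f y)) = ?E (\<lambda>y. (?t1 y + ?t2 y) + (?t3 y + ?t4 y)) x"
      using elim(8) by (simp only: eq)
    also have "\<dots> = (?E ?t1 x + ?E ?t2 x) + (?E ?t3 x + ?E ?t4 x)"
      by (simp only: elim(4,5,6))
    also have "\<dots> = (complex_of_real (?N f) + - cnj (?h x) * ?h x)
        + (- ?h x * cnj (?h x) + ?h x * cnj (?h x) * indicator G x)"
      by (simp only: elim(1,2,3,7,9) h)
    also have "\<dots> = complex_of_real (?N f) - ?h x * cnj (?h x)"
      using hG by (simp add: mult.commute mult.left_commute)
    also have "\<dots> = complex_of_real (?N f - (cmod (?h x))\<^sup>2)"
      by (simp only: of_real_diff sq)
    finally have "complex_of_real (?N (\<lambda>y. f y - proj f y)) = complex_of_real (?N f - (cmod (?h x))\<^sup>2)" .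
    then show ?case unfolding of_real_eq_iff .
  qed
qed

lemma cmod_coeff_le:
  assumes f: "f \<in> cond_L2 M F"
  shows "AE x in M. ennreal ((cmod (coeff f x))\<^sup>2) \<le> nn_cond_exp M F (\<lambda>y. ennreal ((cmod (f y))\<^sup>2)) x"
proof -
  have "AE x in M. nn_cond_exp M F (\<lambda>y. ennreal ((cmod (f y))\<^sup>2)) x < \<infinity>"
    using f by (simp add: cond_L2_def)
  with bessel[OF f] show ?thesis
  proof eventually_elim
    case (elim x)
    have "(cmod (coeff f x))\<^sup>2 \<le> enn2real (nn_cond_exp M F (\<lambda>y. ennreal ((cmod (f y))\<^sup>2)) x)"
      using elim(1) enn2real_nonneg[of "nn_cond_exp M F (\<lambda>y. ennreal ((cmod (f y - proj f y))\<^sup>2)) x"]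
      by linarith
    then have "ennreal ((cmod (coeff f x))\<^sup>2)
        \<le> ennreal (enn2real (nn_cond_exp M F (\<lambda>y. ennreal ((cmod (f y))\<^sup>2)) x))"
      by (rule ennreal_leI)
    also have "\<dots> = nn_cond_exp M F (\<lambda>y. ennreal ((cmod (f y))\<^sup>2)) x"
      using elim(2) by (intro ennreal_enn2real) simp
    finally show ?case .
  qed
qed

text \<open>Conditioning turns the integral of \<open>|coeff f|\<^sup>2 |v|\<^sup>2\<close> into that of \<open>|coeff f|\<^sup>2\<close> over \<open>G\<close>, to which the
conditional Bessel inequality applies.\<close>

lemma proj_L2:
  assumes f: "f \<in> L2_space M"
  shows "proj f \<in> L2_space M" "L2_norm M (proj f) \<le> L2_norm M f"
proof -
  note [measurable] = L2_spaceD(1)[OF f]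
  let ?n = "\<lambda>g. nn_cond_exp M F (\<lambda>y. ennreal ((cmod (g y))\<^sup>2))"
  have "(\<integral>\<^sup>+x. ennreal ((cmod (proj f x))\<^sup>2) \<partial>M)
      = (\<integral>\<^sup>+x. ennreal ((cmod (coeff f x))\<^sup>2) * ennreal ((cmod (v x))\<^sup>2) \<partial>M)"
    unfolding proj_def by (simp add: norm_mult power_mult_distrib ennreal_mult)
  also have "\<dots> = (\<integral>\<^sup>+x. ennreal ((cmod (coeff f x))\<^sup>2) * ?n v x \<partial>M)"
    by (rule nn_cond_exp_intg[symmetric]) measurable
  also have "\<dots> \<le> (\<integral>\<^sup>+x. 1 * ?n f x \<partial>M)"
  proof (rule nn_integral_mono_AE)
    show "AE x in M. ennreal ((cmod (coeff f x))\<^sup>2) * ?n v x \<le> 1 * ?n f x"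
      using cmod_coeff_le[OF L2_imp_cond_L2[OF f]] v_unit
      by eventually_elim (auto simp: indicator_def)
  qed
  also have "\<dots> = (\<integral>\<^sup>+x. 1 * ennreal ((cmod (f x))\<^sup>2) \<partial>M)"
    by (rule nn_cond_exp_intg) measurable
  finally have le: "(\<integral>\<^sup>+x. ennreal ((cmod (proj f x))\<^sup>2) \<partial>M)
      \<le> ennreal (1\<^sup>2) * (\<integral>\<^sup>+x. ennreal ((cmod (f x))\<^sup>2) \<partial>M)" by simp
  show "proj f \<in> L2_space M" by (rule L2_norm_le(1)[OF _ f _ le]) auto
  show "L2_norm M (proj f) \<le> L2_norm M f"
    using L2_norm_le(2)[OF _ f _ le] by simp
qed

lemma proj_diff_L2:
  assumes f: "f \<in> L2_space M"
  shows "AE x in M. proj (\<lambda>y. f y - proj f y) x = 0"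
proof -
  note [measurable] = L2_spaceD(1)[OF f]
  have pf: "(\<lambda>y. (- 1) * proj f y) \<in> cond_L2 M F"
    by (rule cond_L2_mult[OF _ proj_cond_L2]) measurable
  have "AE x in M. proj (\<lambda>y. f y + (- 1) * proj f y) x = proj f x + proj (\<lambda>y. (- 1) * proj f y) x"
    by (rule proj_add[OF L2_imp_cond_L2[OF f] pf])
  moreover have "AE x in M. proj (\<lambda>y. (- 1) * proj f y) x = (- 1) * proj (proj f) x"
    by (rule proj_mult[OF _ proj_cond_L2]) measurable
  moreover have "AE x in M. proj (proj f) x = proj f x" by (rule proj_proj) measurable
  ultimately show ?thesis by eventually_elim simp
qed

text \<open>The vector is a normalised restriction of \<open>v\<close> to a subset of \<open>B\<close> in \<open>F\<close> of finite positive
measure, which exists because the measure is \<open>\<sigma>\<close>-finite on \<open>F\<close>. On these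
vectors \<open>f \<mapsto> \<phi> proj f\<close> acts as multiplication by \<open>\<phi>\<close>, so they serve as test vectors for
eigenvalues, approximate eigenvalues and norms.\<close>

lemma unit_vector_exists:
  assumes B [measurable]: "B \<in> sets F" and "B \<subseteq> G" and pos: "emeasure M B > 0"
  obtains f where "f \<in> L2_space M" "L2_norm M f = 1" "\<And>x. x \<notin> B \<Longrightarrow> f x = 0" "AE x in M. proj f x = f x"
proof -
  let ?R = "restr_to_subalg M F"
  interpret R: sigma_finite_measure ?R by (rule sigma_fin_subalg)
  have "B \<in> sets ?R" using B sets_restr_to_subalg[OF subalg] by simp
  moreover have "0 < emeasure ?R B"
    using pos emeasure_restr_to_subalg[OF subalg B] by simp
  ultimately obtain C where "C \<in> sets ?R" "C \<subseteq> B" "0 < emeasure ?R C" "emeasure ?R C < \<infinity>"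
  proof (cases "emeasure ?R B = \<infinity>")
    case True
    obtain Z where "Z \<in> sets ?R" "Z \<subseteq> B" "emeasure ?R Z < \<infinity>" "emeasure ?R Z > ennreal 0"
      by (rule R.approx_PInf_emeasure_with_finite[OF \<open>B \<in> sets ?R\<close> True, of 0])
    then show thesis by (intro that[of Z]) simp_all
  qed (auto simp: less_top that)
  then have C [measurable]: "C \<in> sets F" and "C \<subseteq> B" and C0: "0 < emeasure M C" and Cfin: "emeasure M C < \<infinity>"
    using sets_restr_to_subalg[OF subalg] emeasure_restr_to_subalg[OF subalg] by auto
  have [measurable]: "C \<in> sets M" using subalg C unfolding subalgebra_def by auto
  define g where "g = (\<lambda>x. complex_of_real (indicator C x) * v x)"
  have [measurable]: "g \<in> borel_measurable M" unfolding g_def by measurable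
  have "(\<integral>\<^sup>+x. ennreal ((cmod (g x))\<^sup>2) \<partial>M) = (\<integral>\<^sup>+x. indicator C x * ennreal ((cmod (v x))\<^sup>2) \<partial>M)"
    by (rule nn_integral_cong) (simp add: g_def indicator_def)
  also have "\<dots> = (\<integral>\<^sup>+x. indicator C x * nn_cond_exp M F (\<lambda>y. ennreal ((cmod (v y))\<^sup>2)) x \<partial>M)"
    by (rule nn_cond_exp_intg[symmetric]) measurable
  also have "\<dots> = (\<integral>\<^sup>+x. indicator C x \<partial>M)"
    using v_unit \<open>C \<subseteq> B\<close> \<open>B \<subseteq> G\<close>
    by (intro nn_integral_cong_AE, elim eventually_mono) (auto simp: indicator_def)
  finally have int: "(\<integral>\<^sup>+x. ennreal ((cmod (g x))\<^sup>2) \<partial>M) = emeasure M C" by simp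
  then have g: "g \<in> L2_space M" using Cfin by (intro L2_spaceI) auto
  have "L2_norm M g \<noteq> 0"
    using L2_norm_power2_ennreal[OF g] C0 unfolding int by auto
  then have "\<not> (AE x in M. g x = 0)" using L2_norm_eq_0_iff[OF g] by blast
  then obtain c where c: "L2_norm M (\<lambda>x. c * g x) = 1" by (rule L2_normalize[OF g])
  have "AE x in M. coeff (\<lambda>y. (c * complex_of_real (indicator C y)) * v y) x = (c * complex_of_real (indicator C x)) * indicator G x"
    by (rule coeff_mult_v) measurable
  then have "AE x in M. proj (\<lambda>x. c * g x) x = c * g x"
    unfolding proj_def g_def mult.assoc[symmetric]
    by eventually_elim (use v_eq_0 in \<open>auto simp: indicator_def\<close>)
  moreover have "c * g x = 0" if "x \<notin> B" for x
    using that \<open>C \<subseteq> B\<close> by (auto simp: g_def indicator_def)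
  ultimately show thesis
    by (intro that[OF L2_scale[OF g] c])
qed

end

section \<open>Spectral theory of a multiplied projection\<close>

text \<open>The norm of a bounded inverse of \<open>T - z\<close> is the reciprocal of a lower bound for \<open>T - z\<close>; it is
replaced by its maximum with \<open>1\<close> because the bounding constant of an operator may be \<open>0\<close> or negative.\<close>

lemma approx_point_spectrum_subset_spectrum:
  assumes T: "bounded_L2_op M T" 
  shows "L2_approx_point_spectrum M T \<subseteq> L2_spectrum M T"
proof
  fix z assume z: "z \<in> L2_approx_point_spectrum M T"
  show "z \<in> L2_spectrum M T"
  proof (rule ccontr)
    assume "z \<notin> L2_spectrum M T"
    then obtain R where R: "bounded_L2_op M R"
      and inv: "\<And>f. f \<in> L2_space M \<Longrightarrow> AE x in M. R (\<lambda>y. T f y - z * f y) x = f x"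
      unfolding L2_spectrum_def by auto
    obtain C where C: "\<And>f. f \<in> L2_space M \<Longrightarrow> L2_norm M (R f) \<le> C * L2_norm M f"
      using R unfolding bounded_L2_op_def by blast
    have "1 / max C 1 * L2_norm M f \<le> L2_norm M (\<lambda>x. T f x - z * f x)" if f: "f \<in> L2_space M" for f
    proof -
      have g: "(\<lambda>x. T f x - z * f x) \<in> L2_space M"
        using T f unfolding bounded_L2_op_def by (intro L2_diff L2_scale) auto
      then have "R (\<lambda>x. T f x - z * f x) \<in> L2_space M"
        using R unfolding bounded_L2_op_def by blast
      then have "L2_norm M f = L2_norm M (R (\<lambda>x. T f x - z * f x))"
        by (intro L2_norm_cong[symmetric] inv f L2_spaceD(1)) auto
      also have "\<dots> \<le> C * L2_norm M (\<lambda>x. T f x - z * f x)" by (rule C[OF g])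
      also have "\<dots> \<le> max C 1 * L2_norm M (\<lambda>x. T f x - z * f x)"
        by (intro mult_right_mono L2_norm_nonneg) auto
      finally show ?thesis by (simp add: field_simps)
    qed
    moreover have "0 < 1 / max C 1" by simp
    ultimately show False using z unfolding L2_approx_point_spectrum_def by blast
  qed
qed

text \<open>The chosen adjoint \<open>A\<close> and any other adjoint \<open>S\<close> differ by a function orthogonal to all of \<open>L\<^sup>2\<close>,
in particular to itself.\<close>

lemma L2_adjoint_eq:
  assumes S: "bounded_L2_op M S"
    and adj: "\<And>f g. f \<in> L2_space M \<Longrightarrow> g \<in> L2_space M \<Longrightarrow> L2_inner M (T f) g = L2_inner M f (S g)"
    and g: "g \<in> L2_space M"
  shows "AE x in M. L2_adjoint M T g x = S g x"
proof -
  define A where "A = L2_adjoint M T"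
  have "bounded_L2_op M A \<and>
     (\<forall>f\<in>L2_space M. \<forall>g\<in>L2_space M. L2_inner M (T f) g = L2_inner M f (A g))"
    unfolding A_def L2_adjoint_def by (rule someI[of _ S]) (use S adj in blast)
  then have A: "A g \<in> L2_space M" and
    inner: "\<And>f. f \<in> L2_space M \<Longrightarrow> L2_inner M f (S g) = L2_inner M f (A g)"
    using g adj unfolding bounded_L2_op_def by auto
  have Sg: "S g \<in> L2_space M" using S g unfolding bounded_L2_op_def by blast
  let ?d = "\<lambda>x. A g x - S g x"
  have d: "?d \<in> L2_space M" by (rule L2_diff[OF A Sg])
  have "(\<integral>x. complex_of_real ((cmod (?d x))\<^sup>2) \<partial>M) = (\<integral>x. ?d x * cnj (A g x) - ?d x * cnj (S g x) \<partial>M)"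
    unfolding complex_norm_square by (simp add: algebra_simps)
  also have "\<dots> = L2_inner M ?d (A g) - L2_inner M ?d (S g)"
    unfolding L2_inner_def
    by (intro Bochner_Integration.integral_diff L2_mult_integrable L2_cnj d A Sg)
  also have "\<dots> = 0" using inner[OF d] by simp
  finally have "(\<integral>x. (cmod (?d x))\<^sup>2 \<partial>M) = 0"
    by (simp del: of_real_power add: integral_complex_of_real)
  then have "L2_norm M ?d = 0" unfolding L2_norm_def by simp
  then have "AE x in M. ?d x = 0" using L2_norm_eq_0_iff[OF d] by blast
  then show ?thesis unfolding A_def by eventually_elim simp
qed

context conditional_unit_vector
begin

text \<open>A property of points of \<open>G\<close> is excluded by testing on vectors that live where it holds. This is
the form in which \<open>unit_vector_exists\<close> is used: for large values of \<open>\<phi>\<close>, for values close to a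
number \<open>z\<close>, and for the value \<open>z\<close> itself.\<close>

lemma AE_on_G_by_unit_vectors:
  assumes Q: "{x \<in> space M. x \<in> G \<and> Q x} \<in> sets F"
    and no: "\<And>f. f \<in> L2_space M \<Longrightarrow> L2_norm M f = 1 \<Longrightarrow> (\<And>x. f x \<noteq> 0 \<Longrightarrow> Q x)
      \<Longrightarrow> AE x in M. proj f x = f x \<Longrightarrow> False"
  shows "AE x in M. x \<in> G \<longrightarrow> \<not> Q x"
proof -
  let ?B = "{x \<in> space M. x \<in> G \<and> Q x}"
  have [measurable]: "?B \<in> sets M" using Q subalg unfolding subalgebra_def by auto
  have "emeasure M ?B = 0"
  proof (rule ccontr)
    assume "emeasure M ?B \<noteq> 0"
    then have "emeasure M ?B > 0" by (simp add: zero_less_iff_neq_zero)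
    then obtain f where "f \<in> L2_space M" "L2_norm M f = 1" "\<And>x. x \<notin> ?B \<Longrightarrow> f x = 0" "AE x in M. proj f x = f x"
      using unit_vector_exists[OF Q] by blast
    then show False using no[of f] by blast
  qed
  then have "AE x in M. \<not> (x \<in> G \<and> Q x)"
    by (subst AE_iff_measurable[of ?B]) auto
  then show ?thesis by eventually_elim blast
qed

text \<open>A unit vector living where \<open>|\<phi>| > |C| + 1\<close> would be stretched by more than \<open>C\<close>. To see this,
it is recovered from its image by dividing by \<open>\<phi>\<close>. The bound \<open>|C| + 1\<close> is positive and exceeds \<open>C\<close>
whatever the sign of \<open>C\<close>.\<close>

lemma multiplier_bounded_of_norm_bound:
  assumes [measurable]: "\<phi> \<in> borel_measurable F"
    and TL2: "\<And>f. f \<in> L2_space M \<Longrightarrow> T f \<in> L2_space M"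
    and T: "\<And>f. f \<in> L2_space M \<Longrightarrow> AE x in M. T f x = \<phi> x * proj f x"
    and C: "\<And>f. f \<in> L2_space M \<Longrightarrow> L2_norm M (T f) \<le> C * L2_norm M f"
  shows "AE x in M. x \<in> G \<longrightarrow> cmod (\<phi> x) \<le> \<bar>C\<bar> + 1"
proof -
  have [measurable]: "\<phi> \<in> borel_measurable M" by (rule measurable_from_subalg[OF subalg]) fact
  let ?D = "\<bar>C\<bar> + 1"
  have sp: "space M = space F" using subalg unfolding subalgebra_def by simp
  have "AE x in M. x \<in> G \<longrightarrow> \<not> (cmod (\<phi> x) > ?D)"
  proof (rule AE_on_G_by_unit_vectors)
    show "{x \<in> space M. x \<in> G \<and> ?D < cmod (\<phi> x)} \<in> sets F" unfolding sp by measurable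
    fix f assume f: "f \<in> L2_space M" and one: "L2_norm M f = 1"
      and supp: "\<And>x. f x \<noteq> 0 \<Longrightarrow> ?D < cmod (\<phi> x)" and pf: "AE x in M. proj f x = f x"
    let ?a = "\<lambda>x. if ?D < cmod (\<phi> x) then 1 / \<phi> x else 0"
    have [measurable]: "f \<in> borel_measurable M" "T f \<in> borel_measurable M"
      using f TL2 L2_spaceD by auto
    have "AE x in M. ?a x * T f x = f x"
      using T[OF f] pf
    proof eventually_elim
      case (elim x)
      show ?case
      proof (cases "f x = 0")
        case False
        moreover from supp[OF this] have "\<phi> x \<noteq> 0" by auto
        ultimately show ?thesis using elim supp[of x] by simp
      qed (use elim in simp)
    qed
    then have "L2_norm M f = L2_norm M (\<lambda>x. ?a x * T f x)"
      by (intro L2_norm_cong[symmetric]; measurable)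
    also have "\<dots> \<le> 1 / ?D * L2_norm M (T f)"
    proof (rule L2_mult_bounded(2)[OF TL2[OF f]])
      show "AE x in M. T f x \<noteq> 0 \<longrightarrow> cmod (?a x) \<le> 1 / ?D"
        by (rule AE_I2) (auto simp: norm_divide intro!: divide_left_mono mult_pos_pos)
      show "?a \<in> borel_measurable M" by measurable
    qed simp
    also have "\<dots> \<le> 1 / ?D * (C * L2_norm M f)"
      by (intro mult_left_mono C f) simp
    also have "\<dots> < 1" unfolding one by (simp add: field_simps)
    finally show False using one by simp
  qed
  then show ?thesis by eventually_elim auto
qed

text \<open>A unit vector living where \<open>|\<phi> - z| < c/2\<close> would be an approximate eigenvector violating the lower
bound \<open>c\<close>. The factor \<open>1/2\<close> provides a strict inequality between the norms without any discussion of
the strictness of integrals.\<close>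

lemma multiplier_bounded_below:
  assumes [measurable]: "\<phi> \<in> borel_measurable F"
    and TL2: "\<And>f. f \<in> L2_space M \<Longrightarrow> T f \<in> L2_space M"
    and T: "\<And>f. f \<in> L2_space M \<Longrightarrow> AE x in M. T f x = \<phi> x * proj f x"
    and "0 < c" and c: "\<And>f. f \<in> L2_space M \<Longrightarrow> c * L2_norm M f \<le> L2_norm M (\<lambda>x. T f x - z * f x)"
  shows "AE x in M. x \<in> G \<longrightarrow> c / 2 \<le> cmod (\<phi> x - z)"
proof -
  have [measurable]: "\<phi> \<in> borel_measurable M" by (rule measurable_from_subalg[OF subalg]) fact
  have sp: "space M = space F" using subalg unfolding subalgebra_def by simp
  have "AE x in M. x \<in> G \<longrightarrow> \<not> (cmod (\<phi> x - z) < c / 2)"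
  proof (rule AE_on_G_by_unit_vectors)
    show "{x \<in> space M. x \<in> G \<and> cmod (\<phi> x - z) < c / 2} \<in> sets F" unfolding sp by measurable
    fix f assume f: "f \<in> L2_space M" and one: "L2_norm M f = 1"
      and supp: "\<And>x. f x \<noteq> 0 \<Longrightarrow> cmod (\<phi> x - z) < c / 2" and pf: "AE x in M. proj f x = f x"
    have [measurable]: "f \<in> borel_measurable M" "T f \<in> borel_measurable M"
      using f TL2 L2_spaceD by auto
    have "AE x in M. T f x - z * f x = (\<phi> x - z) * f x"
      using T[OF f] pf by eventually_elim (simp add: algebra_simps)
    then have "L2_norm M (\<lambda>x. T f x - z * f x) = L2_norm M (\<lambda>x. (\<phi> x - z) * f x)"
      by (intro L2_norm_cong; measurable)
    also have "\<dots> \<le> c / 2 * L2_norm M f"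
    proof (rule L2_mult_bounded(2)[OF f])
      show "AE x in M. f x \<noteq> 0 \<longrightarrow> cmod (\<phi> x - z) \<le> c / 2"
        by (rule AE_I2) (use supp less_imp_le in blast)
    qed (measurable, use \<open>0 < c\<close> in simp)
    finally show False using c[OF f] one \<open>0 < c\<close> by simp
  qed
  then show ?thesis by eventually_elim auto
qed

text \<open>Covers both the operators \<open>f \<mapsto> \<phi> proj f\<close> and their resolvents. Because \<open>proj f\<close> vanishes off \<open>G\<close>,
only the values of \<open>\<alpha>\<close> on \<open>G\<close> matter.\<close>

lemma bounded_L2_op_multiplier_plus_scalar:
  assumes [measurable]: "\<alpha> \<in> borel_measurable M" and C: "AE x in M. x \<in> G \<longrightarrow> cmod (\<alpha> x) \<le> C"
    and meas: "\<And>f. f \<in> L2_space M \<Longrightarrow> S f \<in> borel_measurable M"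
    and S: "\<And>f. f \<in> L2_space M \<Longrightarrow> AE x in M. S f x = \<alpha> x * proj f x + \<beta> * f x"
  shows "bounded_L2_op M S"
proof -
  define D where "D = max C 0"
  have [simp]: "0 \<le> D" unfolding D_def by simp
  have D: "AE x in M. proj f x \<noteq> 0 \<longrightarrow> cmod (\<alpha> x) \<le> D" for f
    using C by eventually_elim (auto simp: D_def proj_def v_eq_0)
  have L2: "(\<lambda>x. \<alpha> x * proj f x) \<in> L2_space M" "L2_norm M (\<lambda>x. \<alpha> x * proj f x) \<le> D * L2_norm M f"
    if f: "f \<in> L2_space M" for f
  proof -
    show "(\<lambda>x. \<alpha> x * proj f x) \<in> L2_space M"
      by (rule L2_mult_bounded(1)[OF proj_L2(1)[OF f] _ _ D]) auto
    have "L2_norm M (\<lambda>x. \<alpha> x * proj f x) \<le> D * L2_norm M (proj f)"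
      by (rule L2_mult_bounded(2)[OF proj_L2(1)[OF f] _ _ D]) auto
    also have "\<dots> \<le> D * L2_norm M f" by (intro mult_left_mono proj_L2(2) f) simp
    finally show "L2_norm M (\<lambda>x. \<alpha> x * proj f x) \<le> D * L2_norm M f" .
  qed
  have sumL2: "(\<lambda>x. \<alpha> x * proj f x + \<beta> * f x) \<in> L2_space M" if f: "f \<in> L2_space M" for f
    by (intro L2_add(1) L2 L2_scale f)
  have S_L2: "S f \<in> L2_space M" if f: "f \<in> L2_space M" for f
  proof (rule L2_cong[OF sumL2[OF f] _ meas[OF f]])
    show "AE x in M. \<alpha> x * proj f x + \<beta> * f x = S f x"
      using S[OF f] by eventually_elim simp
  qed
  show ?thesis unfolding bounded_L2_op_def
  proof (intro conjI ballI allI)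
    show "S f \<in> L2_space M" if "f \<in> L2_space M" for f by (rule S_L2[OF that])
  next
    fix f g assume f: "f \<in> L2_space M" and g: "g \<in> L2_space M"
    show "AE x in M. S (\<lambda>y. f y + g y) x = S f x + S g x"
      using S[OF f] S[OF g] S[OF L2_add(1)[OF f g]] proj_add[OF L2_imp_cond_L2[OF f] L2_imp_cond_L2[OF g]]
      by eventually_elim (simp add: algebra_simps)
  next
    fix c f assume f: "f \<in> L2_space M"
    show "AE x in M. S (\<lambda>y. c * f y) x = c * S f x"
      using S[OF f] S[OF L2_scale[OF f, of c]] proj_mult[OF borel_measurable_const L2_imp_cond_L2[OF f], of c]
      by eventually_elim (simp add: algebra_simps)
  next
    let ?K = "sqrt (2 * D\<^sup>2 + 2 * (cmod \<beta>)\<^sup>2)"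
    have "L2_norm M (S f) \<le> ?K * L2_norm M f" if f: "f \<in> L2_space M" for f
    proof (rule power2_le_imp_le)
      have "(L2_norm M (S f))\<^sup>2 = (L2_norm M (\<lambda>x. \<alpha> x * proj f x + \<beta> * f x))\<^sup>2"
        using L2_norm_cong[OF S[OF f] meas[OF f] L2_spaceD(1)[OF sumL2[OF f]]] by simp
      also have "\<dots> \<le> 2 * (L2_norm M (\<lambda>x. \<alpha> x * proj f x))\<^sup>2 + 2 * (L2_norm M (\<lambda>x. \<beta> * f x))\<^sup>2"
        by (intro L2_add(2) L2 L2_scale f)
      also have "\<dots> \<le> 2 * (D * L2_norm M f)\<^sup>2 + 2 * (cmod \<beta> * L2_norm M f)\<^sup>2"
        unfolding L2_norm_scale using power_mono[OF L2(2)[OF f] L2_norm_nonneg, of 2] by simp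
      also have "\<dots> = (?K * L2_norm M f)\<^sup>2"
        by (simp add: power_mult_distrib algebra_simps)
      finally show "(L2_norm M (S f))\<^sup>2 \<le> (?K * L2_norm M f)\<^sup>2" .
      show "0 \<le> ?K * L2_norm M f" by (simp add: L2_norm_nonneg)
    qed
    then show "\<exists>C. \<forall>f\<in>L2_space M. L2_norm M (S f) \<le> C * L2_norm M f" by blast
  qed
qed

end

text \<open>The abstract normal operator to which weighted conditional expectations reduce. Since operators act on
representatives, \<open>T f\<close> agrees with \<open>\<phi> proj f\<close> only almost everywhere; its measurability is then a
separate requirement.\<close>

locale multiplied_projection = conditional_unit_vector M F v G
  for M F :: "'a measure" and v G +
  fixes \<phi> :: "'a \<Rightarrow> complex" and T :: "('a \<Rightarrow> complex) \<Rightarrow> 'a \<Rightarrow> complex"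
  assumes \<phi>_measurable [measurable]: "\<phi> \<in> borel_measurable F"
    and \<phi>_bounded: "\<exists>C. AE x in M. x \<in> G \<longrightarrow> cmod (\<phi> x) \<le> C"
    and T_measurable: "f \<in> L2_space M \<Longrightarrow> T f \<in> borel_measurable M"
    and T_eq: "f \<in> L2_space M \<Longrightarrow> AE x in M. T f x = \<phi> x * proj f x"
begin

lemma \<phi>_measurable_M [measurable]: "\<phi> \<in> borel_measurable M"
  by (rule measurable_from_subalg[OF subalg]) (rule \<phi>_measurable)

lemma space_F: "space F = space M"
  using subalg unfolding subalgebra_def by simp

lemma bounded_T: "bounded_L2_op M T"
proof -
  obtain C where C: "AE x in M. x \<in> G \<longrightarrow> cmod (\<phi> x) \<le> C" using \<phi>_bounded by blast
  have "AE x in M. T f x = \<phi> x * proj f x + 0 * f x" if "f \<in> L2_space M" for f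
    using T_eq[OF that] by simp
  note eq = this
  show ?thesis
    by (rule bounded_L2_op_multiplier_plus_scalar[OF \<phi>_measurable_M C, where \<beta> = 0])
      (erule T_measurable, erule eq)
qed

lemma T_L2: "f \<in> L2_space M \<Longrightarrow> T f \<in> L2_space M"
  using bounded_T unfolding bounded_L2_op_def by blast

text \<open>The inverse is \<open>proj f / (\<phi> - z) - (f - proj f) / z\<close>, as \<open>T - z\<close> multiplies the range of \<open>proj\<close> by
\<open>\<phi> - z\<close> and its orthogonal complement by \<open>-z\<close>. For \<open>z = 0\<close> the complement must be trivial; the
same formula then remains valid because division by \<open>0\<close> yields \<open>0\<close>.\<close>

lemma resolvent_exists:
  assumes \<epsilon>: "0 < \<epsilon>" and away: "AE x in M. x \<in> G \<longrightarrow> \<epsilon> \<le> cmod (\<phi> x - z)"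
    and z: "z \<noteq> 0 \<or> (\<forall>f\<in>L2_space M. AE x in M. proj f x = f x)"
  shows "z \<notin> L2_spectrum M T"
proof -
  define \<alpha> where "\<alpha> x = 1 / (\<phi> x - z) + 1 / z" for x
  define R where "R f = (\<lambda>x. \<alpha> x * proj f x + (- (1 / z)) * f x)" for f
  have \<alpha>_F [measurable]: "\<alpha> \<in> borel_measurable F" unfolding \<alpha>_def[abs_def] by measurable
  have [measurable]: "\<alpha> \<in> borel_measurable M" by (rule measurable_from_subalg[OF subalg]) (rule \<alpha>_F)
  have R_meas: "R f \<in> borel_measurable M" if "f \<in> L2_space M" for f
    using L2_spaceD(1)[OF that] unfolding R_def by measurable
  have "AE x in M. x \<in> G \<longrightarrow> cmod (\<alpha> x) \<le> 1 / \<epsilon> + cmod (1 / z)"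
    using away
  proof eventually_elim
    case (elim x)
    show ?case
    proof
      assume "x \<in> G"
      then have "cmod (1 / (\<phi> x - z)) \<le> 1 / \<epsilon>"
        using elim \<epsilon> by (simp add: norm_divide frac_le)
      then show "cmod (\<alpha> x) \<le> 1 / \<epsilon> + cmod (1 / z)"
        unfolding \<alpha>_def by (intro order_trans[OF norm_triangle_ineq] add_right_mono)
    qed
  qed
  note \<alpha>_bound = this
  have R: "bounded_L2_op M R"
    by (rule bounded_L2_op_multiplier_plus_scalar[OF _ \<alpha>_bound, where \<beta> = "- (1 / z)"])
      (measurable, erule R_meas, simp add: R_def)
  have R_L2: "R f \<in> L2_space M" if "f \<in> L2_space M" for f
    using R that unfolding bounded_L2_op_def by blast
  have "(AE x in M. R (\<lambda>y. T f y - z * f y) x = f x) \<and> (AE x in M. T (R f) x - z * R f x = f x)"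
    if f: "f \<in> L2_space M" for f
  proof
    have [measurable]: "f \<in> borel_measurable M" "T f \<in> borel_measurable M"
      using f by (simp_all add: L2_spaceD T_measurable)
    have z': "AE x in M. z = 0 \<longrightarrow> proj f x = f x"
      using z f by (cases "z = 0") auto
    let ?g = "\<lambda>y. T f y - z * f y"
    have cf: "f \<in> cond_L2 M F" by (rule L2_imp_cond_L2[OF f])
    have dom: "(\<lambda>y. \<phi> y * proj f y) \<in> cond_L2 M F" "(\<lambda>y. (- z) * f y) \<in> cond_L2 M F"
      by (intro cond_L2_mult proj_cond_L2 cf; measurable)+
    have "AE x in M. proj ?g x = proj (\<lambda>y. \<phi> y * proj f y + (- z) * f y) x"
      by (rule proj_cong) (use T_eq[OF f] in auto)
    moreover have "AE x in M. proj (\<lambda>y. \<phi> y * proj f y + (- z) * f y) x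
        = proj (\<lambda>y. \<phi> y * proj f y) x + proj (\<lambda>y. (- z) * f y) x"
      by (rule proj_add[OF dom])
    moreover have "AE x in M. proj (\<lambda>y. \<phi> y * proj f y) x = \<phi> x * proj (proj f) x"
      by (rule proj_mult[OF _ proj_cond_L2]) measurable
    moreover have "AE x in M. proj (\<lambda>y. (- z) * f y) x = (- z) * proj f x"
      by (rule proj_mult[OF _ cf]) measurable
    moreover have pp: "AE x in M. proj (proj f) x = proj f x"
      by (rule proj_proj) measurable
    ultimately have Pg: "AE x in M. proj ?g x = (\<phi> x - z) * proj f x"
      by eventually_elim (simp add: algebra_simps)
    show "AE x in M. R ?g x = f x"
      using Pg T_eq[OF f] away z'
    proof eventually_elim
      case (elim x)
      show ?case
      proof (cases "x \<in> G")
        case True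
        then have "\<phi> x - z \<noteq> 0" using elim(3) \<epsilon> by auto
        then have "\<alpha> x * (\<phi> x - z) = 1 + (\<phi> x - z) / z"
          unfolding \<alpha>_def by (simp add: distrib_right)
        then have "R ?g x = (1 + (\<phi> x - z) / z) * proj f x - (\<phi> x * proj f x - z * f x) / z"
          unfolding R_def elim(1,2) by (simp add: mult.assoc[symmetric])
        then show ?thesis using elim(4) by (cases "z = 0") (simp_all add: field_simps)
      next
        case False
        then have "proj f x = 0" by (simp add: proj_eq_0)
        then show ?thesis using elim(2,4) proj_eq_0[OF False, of ?g]
          unfolding R_def by (cases "z = 0") simp_all
      qed
    qed
    have dom2: "(\<lambda>y. \<alpha> y * proj f y) \<in> cond_L2 M F" "(\<lambda>y. (- (1 / z)) * f y) \<in> cond_L2 M F"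
      by (intro cond_L2_mult proj_cond_L2 cf; measurable)+
    have "AE x in M. proj (R f) x = proj (\<lambda>y. \<alpha> y * proj f y) x + proj (\<lambda>y. (- (1 / z)) * f y) x"
      unfolding R_def by (rule proj_add[OF dom2])
    moreover have "AE x in M. proj (\<lambda>y. \<alpha> y * proj f y) x = \<alpha> x * proj (proj f) x"
      by (rule proj_mult[OF _ proj_cond_L2]) measurable
    moreover have "AE x in M. proj (\<lambda>y. (- (1 / z)) * f y) x = (- (1 / z)) * proj f x"
      by (rule proj_mult[OF _ cf]) measurable
    ultimately have PR: "AE x in M. proj (R f) x = 1 / (\<phi> x - z) * proj f x"
      using pp by eventually_elim (simp add: \<alpha>_def algebra_simps)
    show "AE x in M. T (R f) x - z * R f x = f x"
      using PR T_eq[OF R_L2[OF f]] away z'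
    proof eventually_elim
      case (elim x)
      show ?case
      proof (cases "x \<in> G")
        case True
        then have nz: "\<phi> x - z \<noteq> 0" using elim(3) \<epsilon> by auto
        show ?thesis
        proof (cases "z = 0")
          case True
          then show ?thesis using elim nz by (simp add: R_def)
        next
          case False
          have alg: "a * (q * p) - z * ((q + r) * p + - r * t) = (a - z) * q * p - (z * r) * p + (z * r) * t"
            for a q p r t :: complex
            by (simp add: algebra_simps)
          have "T (R f) x - z * R f x
              = (\<phi> x - z) * (1 / (\<phi> x - z)) * proj f x - (z * (1 / z)) * proj f x + (z * (1 / z)) * f x"
            unfolding elim(1,2) unfolding R_def \<alpha>_def by (rule alg)
          then show ?thesis using nz False by simp
        qed
      next
        case False
        then have "proj f x = 0" by (simp add: proj_eq_0)
        then show ?thesis using elim by (cases "z = 0") (simp_all add: R_def)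
      qed
    qed
  qed
  with R show ?thesis unfolding L2_spectrum_def by blast
qed

lemma not_approx_spectrum_imp_away:
  assumes "z \<notin> L2_approx_point_spectrum M T"
  obtains \<epsilon> where "0 < \<epsilon>" "AE x in M. x \<in> G \<longrightarrow> \<epsilon> \<le> cmod (\<phi> x - z)"
proof -
  obtain c where "0 < c" and c: "\<And>f. f \<in> L2_space M \<Longrightarrow> c * L2_norm M f \<le> L2_norm M (\<lambda>x. T f x - z * f x)"
    using assms unfolding L2_approx_point_spectrum_def by auto
  have "AE x in M. x \<in> G \<longrightarrow> c / 2 \<le> cmod (\<phi> x - z)"
    by (rule multiplier_bounded_below[OF \<phi>_measurable T_L2 T_eq \<open>0 < c\<close> c])
  then show thesis by (rule that[rotated]) (use \<open>0 < c\<close> in simp)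
qed

text \<open>Nonzero spectral values are the values in the essential range of \<open>\<phi>\<close> on \<open>G\<close>: away from it there is
a resolvent, and on it there are approximate eigenvectors.\<close>

lemma spectrum_iff:
  assumes "z \<noteq> 0"
  shows "z \<in> L2_spectrum M T \<longleftrightarrow> \<not> (\<exists>\<epsilon>>0. AE x in M. x \<in> G \<longrightarrow> \<epsilon> \<le> cmod (\<phi> x - z))"
  using resolvent_exists[of _ z] assms not_approx_spectrum_imp_away[of z]
    approx_point_spectrum_subset_spectrum[OF bounded_T] by blast

lemma approx_point_spectrum_eq_spectrum:
  "L2_approx_point_spectrum M T - {0} = L2_spectrum M T - {0}"
  using resolvent_exists not_approx_spectrum_imp_away
    approx_point_spectrum_subset_spectrum[OF bounded_T] by blast

text \<open>Applying \<open>proj\<close> to \<open>\<phi> proj f = z f\<close> gives \<open>(\<phi> - z) proj f = 0\<close>. If \<open>\<phi> \<noteq> z\<close> almost everywhere, then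
\<open>proj f = 0\<close> and hence \<open>z f = 0\<close>.\<close>

lemma eigenvalue_imp_level_set:
  assumes "z \<in> L2_point_spectrum M T" "z \<noteq> 0"
  shows "\<not> (AE x in M. x \<in> G \<longrightarrow> \<phi> x \<noteq> z)"
proof
  assume ne: "AE x in M. x \<in> G \<longrightarrow> \<phi> x \<noteq> z"
  obtain f where f: "f \<in> L2_space M" and one: "L2_norm M f = 1" and ev: "AE x in M. T f x - z * f x = 0"
    using assms(1) unfolding L2_point_spectrum_def by auto
  have [measurable]: "f \<in> borel_measurable M" by (rule L2_spaceD(1)[OF f])
  have ev': "AE x in M. \<phi> x * proj f x = z * f x"
    using ev T_eq[OF f] by eventually_elim simp
  then have "AE x in M. proj (\<lambda>y. \<phi> y * proj f y) x = proj (\<lambda>y. z * f y) x"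
    by (rule proj_cong) measurable
  moreover have "AE x in M. proj (\<lambda>y. \<phi> y * proj f y) x = \<phi> x * proj (proj f) x"
    by (rule proj_mult[OF _ proj_cond_L2]) measurable
  moreover have "AE x in M. proj (\<lambda>y. z * f y) x = z * proj f x"
    by (rule proj_mult[OF _ L2_imp_cond_L2[OF f]]) measurable
  moreover have "AE x in M. proj (proj f) x = proj f x" by (rule proj_proj) measurable
  ultimately have "AE x in M. f x = 0"
    using ne ev'
  proof eventually_elim
    case (elim x)
    then have "proj f x = 0" by (cases "x \<in> G") (auto simp: proj_eq_0)
    then show ?case using elim \<open>z \<noteq> 0\<close> by simp
  qed
  then show False using one L2_norm_eq_0_iff[OF f] by simp
qed

lemma level_set_imp_eigenvector:
  assumes "\<not> (AE x in M. x \<in> G \<longrightarrow> \<phi> x \<noteq> z)"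
  obtains f where "f \<in> L2_space M" "L2_norm M f = 1" "AE x in M. proj f x = f x" "\<And>x. f x \<noteq> 0 \<Longrightarrow> \<phi> x = z"
proof (rule ccontr)
  assume no: "\<not> thesis"
  have "AE x in M. x \<in> G \<longrightarrow> \<not> (\<phi> x = z)"
  proof (rule AE_on_G_by_unit_vectors)
    show "{x \<in> space M. x \<in> G \<and> \<phi> x = z} \<in> sets F"
      unfolding space_F[symmetric] by measurable
  qed (use no that in blast)
  then show False using assms by simp
qed

lemma eigenvectorI:
  assumes f: "f \<in> L2_space M" and pf: "AE x in M. proj f x = f x"
    and supp: "\<And>x. f x \<noteq> 0 \<Longrightarrow> \<phi> x = z"
  shows "AE x in M. T f x - z * f x = 0"
  using T_eq[OF f] pf
proof eventually_elim
  case (elim x)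
  then show ?case using supp[of x] by (cases "f x = 0") simp_all
qed

lemma level_set_imp_eigenvalue:
  assumes "\<not> (AE x in M. x \<in> G \<longrightarrow> \<phi> x \<noteq> z)"
  shows "z \<in> L2_point_spectrum M T"
proof -
  obtain f where f: "f \<in> L2_space M" "L2_norm M f = 1" "AE x in M. proj f x = f x"
    and supp: "\<And>x. f x \<noteq> 0 \<Longrightarrow> \<phi> x = z"
    using level_set_imp_eigenvector[OF assms] by blast
  have "AE x in M. T f x - z * f x = 0"
    by (rule eigenvectorI[OF f(1,3) supp])
  with f show ?thesis unfolding L2_point_spectrum_def by blast
qed

text \<open>Each \<open>f - proj f\<close> lies in the kernel of \<open>T\<close>.\<close>

lemma not_eigenvalue_0_imp_proj_id:
  assumes "0 \<notin> L2_point_spectrum M T" and f: "f \<in> L2_space M"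
  shows "AE x in M. proj f x = f x"
proof (rule ccontr)
  assume ne: "\<not> (AE x in M. proj f x = f x)"
  let ?g = "\<lambda>x. f x - proj f x"
  have g: "?g \<in> L2_space M" by (intro L2_diff f proj_L2)
  have "\<not> (AE x in M. ?g x = 0)"
  proof
    assume "AE x in M. ?g x = 0"
    then have "AE x in M. proj f x = f x" by eventually_elim simp
    with ne show False ..
  qed
  then obtain c where c: "L2_norm M (\<lambda>x. c * ?g x) = 1" by (rule L2_normalize[OF g])
  have "AE x in M. T (\<lambda>x. c * ?g x) x - 0 * (c * ?g x) = 0"
    using T_eq[OF L2_scale[OF g, of c]] proj_mult[OF borel_measurable_const L2_imp_cond_L2[OF g], of c]
      proj_diff_L2[OF f]
    by eventually_elim simp
  then have "0 \<in> L2_point_spectrum M T"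
    unfolding L2_point_spectrum_def using c L2_scale[OF g, of c] by blast
  with assms(1) show False ..
qed

text \<open>Each point near \<open>z\<close> other than \<open>z\<close> and \<open>0\<close> has a neighbourhood whose preimage under \<open>\<phi>\<close> in \<open>G\<close> is null.
By the Lindelof property countably many of these neighbourhoods cover the punctured disc, so the whole of it
has a null preimage. If the level set of \<open>z\<close> were null too, \<open>|\<phi> - z|\<close> would be bounded away from
\<open>0\<close> on \<open>G\<close>, making \<open>T - z\<close> invertible.\<close>

lemma isolated_spectrum_imp_eigenvalue:
  assumes "z isolated_in (L2_spectrum M T)"
  shows "z \<in> L2_point_spectrum M T"
proof (rule ccontr)
  assume not_ev: "z \<notin> L2_point_spectrum M T"
  obtain U where zU: "z \<in> L2_spectrum M T" and "open U" and U: "U \<inter> L2_spectrum M T = {z}"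
    using assms unfolding isolated_in_def by blast
  then obtain \<delta> where "0 < \<delta>" and \<delta>: "ball z \<delta> \<subseteq> U"
    by (metis IntD1 insertI1 open_contains_ball)
  let ?D = "ball z \<delta> - {z, 0}"
  have "\<exists>\<epsilon>>0. AE x in M. x \<in> G \<longrightarrow> \<epsilon> \<le> cmod (\<phi> x - y)" if "y \<in> ?D" for y
    using spectrum_iff[of y] that U \<delta> by blast
  then obtain \<epsilon> where \<epsilon>0: "\<And>y. y \<in> ?D \<Longrightarrow> 0 < \<epsilon> y"
    and \<epsilon>: "\<And>y. y \<in> ?D \<Longrightarrow> AE x in M. x \<in> G \<longrightarrow> \<epsilon> y \<le> cmod (\<phi> x - y)"
    by metis
  obtain \<F> where \<F>: "\<F> \<subseteq> (\<lambda>y. ball y (\<epsilon> y)) ` ?D" "countable \<F>"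
    "\<Union>\<F> = \<Union>((\<lambda>y. ball y (\<epsilon> y)) ` ?D)"
    using Lindelof[of "(\<lambda>y. ball y (\<epsilon> y)) ` ?D"] by auto
  have "AE x in M. \<forall>B\<in>\<F>. x \<in> G \<longrightarrow> \<phi> x \<notin> B"
  proof (rule AE_ball_countable'[OF _ \<F>(2)])
    fix B assume "B \<in> \<F>"
    then obtain y where y: "y \<in> ?D" and B: "B = ball y (\<epsilon> y)" using \<F>(1) by blast
    show "AE x in M. x \<in> G \<longrightarrow> \<phi> x \<notin> B"
      using \<epsilon>[OF y] unfolding B by eventually_elim (auto simp: dist_norm norm_minus_commute)
  qed
  then have gap: "AE x in M. x \<in> G \<longrightarrow> \<phi> x \<notin> ?D"
  proof eventually_elim
    case (elim x)
    show ?case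
    proof (intro impI notI)
      assume "x \<in> G" "\<phi> x \<in> ?D"
      then have "\<phi> x \<in> \<Union>\<F>" unfolding \<F>(3) using \<epsilon>0 by force
      then show False using elim \<open>x \<in> G\<close> by blast
    qed
  qed
  have not_z: "AE x in M. x \<in> G \<longrightarrow> \<phi> x \<noteq> z"
    using level_set_imp_eigenvalue not_ev by blast
  \<comment> \<open>The point \<open>0\<close> was not controlled by \<open>spectrum_iff\<close>; it is at distance \<open>|z|\<close> from \<open>z\<close>.\<close>
  define \<eta> where "\<eta> = (if z = 0 then \<delta> else min \<delta> (cmod z))"
  have "0 < \<eta>" using \<open>0 < \<delta>\<close> by (simp add: \<eta>_def)
  moreover have "AE x in M. x \<in> G \<longrightarrow> \<eta> \<le> cmod (\<phi> x - z)"
    using gap not_z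
  proof eventually_elim
    case (elim x)
    show ?case
    proof
      assume "x \<in> G"
      then have "\<phi> x \<noteq> z" "\<phi> x = 0 \<or> \<delta> \<le> cmod (\<phi> x - z)"
        using elim by (auto simp: dist_norm norm_minus_commute)
      then show "\<eta> \<le> cmod (\<phi> x - z)" by (auto simp: \<eta>_def)
    qed
  qed
  moreover have "z \<noteq> 0 \<or> (\<forall>f\<in>L2_space M. AE x in M. proj f x = f x)"
    using not_eigenvalue_0_imp_proj_id not_ev by blast
  ultimately have "z \<notin> L2_spectrum M T" by (rule resolvent_exists)
  with zU show False by contradiction
qed

end

text \<open>Both inner products equal the integral of \<open>\<phi> E(cnj v f) cnj (E(cnj v g))\<close>, obtained by conditioning
the integrand and taking out the \<open>F\<close>-measurable factors.\<close>

lemma multiplied_projection_adjoint: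
  assumes T: "multiplied_projection M F v G \<phi> T"
    and S: "multiplied_projection M F v G (\<lambda>x. cnj (\<phi> x)) S"
    and f: "f \<in> L2_space M" and g: "g \<in> L2_space M"
  shows "L2_inner M (T f) g = L2_inner M f (S g)"
proof -
  interpret T: multiplied_projection M F v G \<phi> T by fact
  interpret S: multiplied_projection M F v G "\<lambda>x. cnj (\<phi> x)" S by fact
  note [measurable] = L2_spaceD(1)[OF f] L2_spaceD(1)[OF g] T.T_measurable[OF f] S.T_measurable[OF g]
  let ?E = "complex_cond_exp M F"
  let ?a = "\<lambda>x. \<phi> x * T.coeff f x" and ?b = "\<lambda>x. \<phi> x * cnj (T.coeff g x)"
  have cf: "f \<in> cond_L2 M F" and cg: "g \<in> cond_L2 M F" by (rule T.L2_imp_cond_L2; fact)+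
  have Tg: "integrable M (\<lambda>x. T f x * cnj (g x))"
    by (intro L2_mult_integrable T.T_L2 L2_cnj f g)
  have fS: "integrable M (\<lambda>x. f x * cnj (S g x))"
    by (intro L2_mult_integrable S.T_L2 L2_cnj f g)
  have eqT: "AE x in M. T f x * cnj (g x) = ?a x * cnj (cnj (v x) * g x)"
    using T.T_eq[OF f] by eventually_elim (simp add: T.proj_def)
  have eqS: "AE x in M. f x * cnj (S g x) = ?b x * (cnj (v x) * f x)"
    using S.T_eq[OF g] by eventually_elim (simp add: T.proj_def)
  have ia: "integrable M (\<lambda>x. ?a x * cnj (cnj (v x) * g x))"
    by (rule integrable_cong_AE_imp[OF Tg _ eqT]) measurable
  have ib: "integrable M (\<lambda>x. ?b x * (cnj (v x) * f x))"
    by (rule integrable_cong_AE_imp[OF fS _ eqS]) measurable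
  have "L2_inner M (T f) g = (\<integral>x. ?a x * cnj (cnj (v x) * g x) \<partial>M)"
    unfolding L2_inner_def by (rule integral_cong_AE[OF _ _ eqT]) measurable
  also have "\<dots> = (\<integral>x. ?E (\<lambda>x. ?a x * cnj (cnj (v x) * g x)) x \<partial>M)"
    by (rule T.complex_cond_exp_integral(2)[OF ia, symmetric])
  also have "\<dots> = (\<integral>x. ?E (\<lambda>x. ?b x * (cnj (v x) * f x)) x \<partial>M)"
  proof (rule integral_cong_AE)
    have "AE x in M. ?E (\<lambda>x. ?a x * cnj (cnj (v x) * g x)) x = ?a x * ?E (\<lambda>x. cnj (cnj (v x) * g x)) x"
      by (rule T.complex_cond_exp_mult[OF _ cond_exp_dom_cnj[OF T.coeff_dom[OF cg]]]) measurable
    moreover have "AE x in M. ?E (\<lambda>x. ?b x * (cnj (v x) * f x)) x = ?b x * ?E (\<lambda>x. cnj (v x) * f x) x"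
      by (rule T.complex_cond_exp_mult[OF _ T.coeff_dom[OF cf]]) measurable
    ultimately show "AE x in M. ?E (\<lambda>x. ?a x * cnj (cnj (v x) * g x)) x = ?E (\<lambda>x. ?b x * (cnj (v x) * f x)) x"
    proof eventually_elim
      case (elim x)
      have coeffs: "?E (\<lambda>x. cnj (cnj (v x) * g x)) x = cnj (T.coeff g x)"
        "?E (\<lambda>x. cnj (v x) * f x) x = T.coeff f x"
        unfolding T.coeff_def by (rule complex_cond_exp_cnj, rule refl)
      show ?case unfolding elim coeffs by (simp only: mult.assoc mult.commute mult.left_commute)
    qed
  qed measurable
  also have "\<dots> = (\<integral>x. ?b x * (cnj (v x) * f x) \<partial>M)"
    by (rule T.complex_cond_exp_integral(2)[OF ib])
  also have "\<dots> = L2_inner M f (S g)"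
    unfolding L2_inner_def by (rule integral_cong_AE[OF _ _ eqS, symmetric]) measurable
  finally show ?thesis .
qed

section \<open>Equality in the conditional Cauchy-Schwarz inequality\<close>

lemma ennreal_sqrt_eq_0_iff: "ennreal_sqrt a = 0 \<longleftrightarrow> a = 0"
proof (cases "a = \<infinity>")
  case False
  then have "ennreal (enn2real a) = a" by (simp add: less_top)
  moreover have "ennreal_sqrt a = 0 \<longleftrightarrow> enn2real a \<le> 0"
    using False by (simp add: ennreal_sqrt_def ennreal_eq_0_iff)
  ultimately show ?thesis by (metis enn2real_0 ennreal_eq_0_iff order_refl)
qed (simp add: ennreal_sqrt_def)

text \<open>Equality in the conditional Cauchy-Schwarz inequality makes \<open>w\<close> a multiple of
\<open>v = cnj u / sqrt U\<close> over \<open>G\<close>, the set where this normalisation is possible, and forces \<open>u\<close> or \<open>w\<close> to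
vanish elsewhere.\<close>

locale cauchy_schwarz_equality = sigma_finite_subalgebra M F for M F :: "'a measure" +
  fixes u w :: "'a \<Rightarrow> complex"
  assumes u_measurable [measurable]: "u \<in> borel_measurable M"
    and w_measurable [measurable]: "w \<in> borel_measurable M"
    and equality: "AE x in M. nn_cond_exp M F (\<lambda>y. ennreal ((cmod (u y))\<^sup>2)) x \<noteq> 0 \<longrightarrow>
        ennreal (cmod (complex_cond_exp M F (\<lambda>y. u y * w y) x)) =
          ennreal_sqrt (nn_cond_exp M F (\<lambda>y. ennreal ((cmod (u y))\<^sup>2)) x) *
          ennreal_sqrt (nn_cond_exp M F (\<lambda>y. ennreal ((cmod (w y))\<^sup>2)) x)"
begin

abbreviation U :: "'a \<Rightarrow> ennreal" where "U \<equiv> nn_cond_exp M F (\<lambda>y. ennreal ((cmod (u y))\<^sup>2))"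
abbreviation W :: "'a \<Rightarrow> ennreal" where "W \<equiv> nn_cond_exp M F (\<lambda>y. ennreal ((cmod (w y))\<^sup>2))"

definition G :: "'a set" where "G = {x \<in> space M. U x \<noteq> 0 \<and> U x \<noteq> \<infinity>}"

definition s :: "'a \<Rightarrow> real" where "s x = sqrt (enn2real (U x))"

definition v :: "'a \<Rightarrow> complex" where
  "v x = complex_of_real (indicator G x / s x) * cnj (u x)"

definition \<phi> :: "'a \<Rightarrow> complex" where
  "\<phi> = complex_cond_exp M F (\<lambda>y. u y * w y)"

lemma level_set_U: "{x \<in> space M. U x = a} \<in> sets F"
proof -
  have "space M = space F" using subalg unfolding subalgebra_def by simp
  then show ?thesis by simp
qed

lemma G_sets [measurable]: "G \<in> sets F"
proof -
  have "space M = space F" using subalg unfolding subalgebra_def by simp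
  then show ?thesis unfolding G_def by simp
qed

lemma s_measurable [measurable]: "s \<in> borel_measurable F" "s \<in> borel_measurable M"
  unfolding s_def[abs_def] by measurable

lemma s_pos: "x \<in> G \<Longrightarrow> 0 < s x"
  unfolding G_def s_def by (auto simp: enn2real_positive_iff less_top zero_less_iff_neq_zero)

lemma s_power2: "x \<in> G \<Longrightarrow> ennreal ((s x)\<^sup>2) = U x"
  unfolding G_def s_def by (simp add: less_top)

sublocale conditional_unit_vector M F v G
proof
  have [measurable]: "G \<in> sets M" using G_sets subalg unfolding subalgebra_def by auto
  show v: "v \<in> borel_measurable M" unfolding v_def[abs_def] by measurable
  show "v x = 0" if "x \<notin> G" for x using that by (simp add: v_def)
  have "AE x in M. ennreal (indicator G x / (s x)\<^sup>2) * U x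
      = nn_cond_exp M F (\<lambda>y. ennreal (indicator G y / (s y)\<^sup>2) * ennreal ((cmod (u y))\<^sup>2)) x"
    by (rule nn_cond_exp_prod) measurable
  moreover have "(\<lambda>y. ennreal (indicator G y / (s y)\<^sup>2) * ennreal ((cmod (u y))\<^sup>2)) = (\<lambda>y. ennreal ((cmod (v y))\<^sup>2))"
    by (auto simp: v_def norm_mult norm_divide power_mult_distrib power_divide ennreal_mult[symmetric] indicator_def)
  ultimately have "AE x in M. ennreal (indicator G x / (s x)\<^sup>2) * U x
      = nn_cond_exp M F (\<lambda>y. ennreal ((cmod (v y))\<^sup>2)) x"
    by (simp only:)
  then show "AE x in M. nn_cond_exp M F (\<lambda>y. ennreal ((cmod (v y))\<^sup>2)) x = indicator G x"
  proof eventually_elim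
    case (elim x)
    have "ennreal (indicator G x / (s x)\<^sup>2) * U x = indicator G x"
    proof (cases "x \<in> G")
      case True
      then show ?thesis
        using s_pos[OF True] by (simp add: s_power2[symmetric] ennreal_mult[symmetric])
    qed simp
    with elim show ?case by simp
  qed
qed (rule G_sets)

lemma u_eq: "x \<in> G \<Longrightarrow> u x = complex_of_real (s x) * cnj (v x)"
  using s_pos[of x] by (simp add: v_def)

lemma \<phi>_measurable [measurable]: "\<phi> \<in> borel_measurable F"
  unfolding \<phi>_def by measurable

lemma u_eq_0: "AE x in M. U x = 0 \<longrightarrow> u x = 0"
  by (rule AE_eq_0_of_nn_cond_exp_eq_0) measurable

text \<open>On \<open>U = \<infinity>\<close> the Cauchy-Schwarz equality reads \<open>|E(uw)| = \<infinity> sqrt W\<close>; its left-hand side being finite, \<open>W = 0\<close>.\<close>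

lemma w_eq_0: "AE x in M. U x = \<infinity> \<longrightarrow> w x = 0"
proof -
  have "AE x in M. W x = 0 \<longrightarrow> w x = 0"
    by (rule AE_eq_0_of_nn_cond_exp_eq_0) measurable
  with equality show ?thesis
  proof eventually_elim
    case (elim x)
    show ?case
    proof
      assume U: "U x = \<infinity>"
      then have "ennreal (cmod (\<phi> x)) = \<infinity> * ennreal_sqrt (W x)"
        using elim by (simp add: ennreal_sqrt_def \<phi>_def)
      then have "ennreal_sqrt (W x) = 0"
        by (metis ennreal_neq_top ennreal_top_mult infinity_ennreal_def)
      then show "w x = 0" using elim by (simp add: ennreal_sqrt_eq_0_iff)
    qed
  qed
qed

lemma \<phi>_eq_0: "AE x in M. x \<notin> G \<longrightarrow> \<phi> x = 0"
proof -
  have "AE x in M. x \<in> space M - G \<longrightarrow> u x * w x = 0"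
    using u_eq_0 w_eq_0 by eventually_elim (auto simp: G_def)
  then have "AE x in M. x \<in> space M - G \<longrightarrow> \<phi> x = 0"
    unfolding \<phi>_def
    by (rule complex_cond_exp_eq_0_on[OF compl_G_sets, rotated]) measurable
  with AE_space show ?thesis by eventually_elim simp
qed

lemma cond_exp_u_mult:
  assumes [measurable]: "f \<in> borel_measurable M"
  shows "AE x in M. x \<in> G \<longrightarrow> complex_cond_exp M F (\<lambda>y. u y * f y) x = complex_of_real (s x) * coeff f x"
proof -
  have "AE x in M. x \<in> G \<longrightarrow> complex_cond_exp M F (\<lambda>y. u y * f y) x
      = complex_cond_exp M F (\<lambda>y. complex_of_real (s y) * (cnj (v y) * f y)) x"
    by (rule complex_cond_exp_cong_on[OF G_sets]) (auto simp: u_eq)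
  moreover have "AE x in M. complex_cond_exp M F (\<lambda>y. complex_of_real (s y) * (cnj (v y) * f y)) x
      = complex_of_real (s x) * coeff f x"
    unfolding coeff_def by (rule complex_cond_exp_mult_real) measurable
  ultimately show ?thesis by eventually_elim simp
qed

lemma \<phi>_eq: "AE x in M. x \<in> G \<longrightarrow> \<phi> x = complex_of_real (s x) * coeff w x"
  unfolding \<phi>_def by (rule cond_exp_u_mult) measurable

text \<open>The truncation of \<open>w\<close> to \<open>G\<close> is conditionally square integrable, since \<open>W\<close> is finite where \<open>U \<noteq> 0\<close>. Its
Bessel defect over \<open>G\<close> is \<open>W - |\<phi>|\<^sup>2 / U\<close>, which vanishes by the Cauchy-Schwarz equality, so it
coincides with its projection.\<close>

lemma w_eq: "AE x in M. x \<in> G \<longrightarrow> w x = coeff w x * v x"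
proof -
  let ?w = "\<lambda>x. complex_of_real (indicator G x) * w x"
  let ?n = "\<lambda>g. nn_cond_exp M F (\<lambda>y. ennreal ((cmod (g y))\<^sup>2))"
  let ?d = "\<lambda>y. ?w y - proj ?w y"
  have [measurable]: "?w \<in> borel_measurable M" by measurable
  have W_fin: "AE x in M. x \<in> G \<longrightarrow> W x \<noteq> \<infinity>"
    using equality
  proof eventually_elim
    case (elim x)
    show ?case
    proof
      assume "x \<in> G"
      then have "U x \<noteq> 0" by (simp add: G_def)
      then have "ennreal (cmod (\<phi> x)) = ennreal_sqrt (U x) * ennreal_sqrt (W x)" "ennreal_sqrt (U x) \<noteq> 0"
        using elim by (auto simp: \<phi>_def ennreal_sqrt_eq_0_iff)
      then have "ennreal_sqrt (W x) \<noteq> \<infinity>"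
        by (metis ennreal_mult_top ennreal_neq_top infinity_ennreal_def)
      then show "W x \<noteq> \<infinity>" by (auto simp: ennreal_sqrt_def)
    qed
  qed
  have "AE x in M. indicator G x * W x = nn_cond_exp M F (\<lambda>y. indicator G y * ennreal ((cmod (w y))\<^sup>2)) x"
    by (rule nn_cond_exp_prod) measurable
  moreover have "(\<lambda>y. indicator G y * ennreal ((cmod (w y))\<^sup>2)) = (\<lambda>y. ennreal ((cmod (?w y))\<^sup>2))"
    by (auto simp: indicator_def)
  ultimately have nw: "AE x in M. ?n ?w x = indicator G x * W x"
    by (elim eventually_mono) simp
  then have "AE x in M. ?n ?w x < \<infinity>"
    using W_fin by eventually_elim (auto simp: indicator_def less_top)
  then have w_L2: "?w \<in> cond_L2 M F" unfolding cond_L2_def by simp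
  have "?d \<in> cond_L2 M F"
  proof -
    have "(\<lambda>y. ?w y + (- 1) * proj ?w y) \<in> cond_L2 M F"
      by (intro cond_L2_add[OF w_L2] cond_L2_mult proj_cond_L2) measurable
    then show ?thesis by simp
  qed
  then have d_fin: "AE x in M. ?n ?d x < \<infinity>" unfolding cond_L2_def by simp
  have coeff_w: "AE x in M. x \<in> G \<longrightarrow> coeff ?w x = coeff w x"
    unfolding coeff_def by (rule complex_cond_exp_cong_on[OF G_sets]) auto
  have "AE x in M. x \<in> G \<longrightarrow> ?n ?d x = 0"
    using equality \<phi>_eq bessel[OF w_L2] nw W_fin d_fin coeff_w
  proof eventually_elim
    case (elim x)
    show ?case
    proof
      assume x: "x \<in> G"
      have "ennreal (cmod (\<phi> x)) = ennreal (s x) * ennreal (sqrt (enn2real (W x)))"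
        using elim x unfolding \<phi>_def[symmetric] by (simp add: G_def s_def ennreal_sqrt_def)
      then have "cmod (\<phi> x) = s x * sqrt (enn2real (W x))"
        using s_pos[OF x] by (simp add: ennreal_mult[symmetric] less_imp_le)
      moreover have "cmod (\<phi> x) = s x * cmod (coeff w x)"
        using elim x s_pos[OF x] by (simp add: norm_mult)
      ultimately have "cmod (coeff w x) = sqrt (enn2real (W x))"
        using s_pos[OF x] by simp
      then have "(cmod (coeff ?w x))\<^sup>2 = enn2real (?n ?w x)"
        using elim x by simp
      then have "enn2real (?n ?d x) = 0"
        using elim(3) by simp
      then show "?n ?d x = 0"
        using elim(6) by (auto simp: enn2real_eq_0_iff)
    qed
  qed
  moreover have "AE x in M. ?n ?d x = 0 \<longrightarrow> ?d x = 0"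
    by (rule AE_eq_0_of_nn_cond_exp_eq_0) measurable
  ultimately show ?thesis
    using coeff_w
  proof eventually_elim
    case (elim x)
    show ?case
    proof
      assume x: "x \<in> G"
      then have "?d x = 0" using elim(1,2) by blast
      then show "w x = coeff w x * v x" using elim(3) x by (simp add: proj_def)
    qed
  qed
qed

text \<open>On \<open>G\<close>, writing \<open>w = E(cnj v w) v\<close> and \<open>u = sqrt U cnj v\<close> turns \<open>w E(uf)\<close> into
\<open>sqrt U E(cnj v w) E(cnj v f) v\<close>, whose first two factors multiply to \<open>\<phi>\<close>. Off \<open>G\<close> both sides
vanish.\<close>

lemma weighted_cond_exp_eq:
  assumes f: "f \<in> borel_measurable M"
  shows "AE x in M. weighted_cond_exp M F w u f x = \<phi> x * proj f x"
proof -
  note [measurable] = f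
  have "AE x in M. x \<in> {x \<in> space M. U x = 0} \<longrightarrow> complex_cond_exp M F (\<lambda>y. u y * f y) x = 0"
  proof (rule complex_cond_exp_eq_0_on[OF level_set_U])
    show "AE x in M. x \<in> {x \<in> space M. U x = 0} \<longrightarrow> u x * f x = 0"
      using u_eq_0 by eventually_elim simp
  qed measurable
  then show ?thesis
    using cond_exp_u_mult[OF f] \<phi>_eq w_eq w_eq_0 AE_space
  proof eventually_elim
    case (elim x)
    show ?case
    proof (cases "x \<in> G")
      case True
      then show ?thesis using elim by (simp add: weighted_cond_exp_def proj_def)
    next
      case False
      then have "U x = 0 \<or> U x = \<infinity>" using elim by (auto simp: G_def)
      then show ?thesis using elim proj_eq_0[OF False, of f] by (auto simp: weighted_cond_exp_def)
    qed
  qed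
qed

text \<open>Here \<open>w\<close> sits under the conditional expectation. Its coefficient \<open>E(cnj v w)\<close> is complex and can be
taken out only because \<open>cnj v f\<close> belongs to the domain of \<open>E\<close>, which is why \<open>f\<close> has to be
conditionally square integrable.\<close>

lemma weighted_cond_exp_cnj_eq:
  assumes f: "f \<in> cond_L2 M F"
  shows "AE x in M. weighted_cond_exp M F (\<lambda>x. cnj (u x)) (\<lambda>x. cnj (w x)) f x = cnj (\<phi> x) * proj f x"
proof -
  have [measurable]: "f \<in> borel_measurable M" using f by (simp add: cond_L2_def)
  have "AE x in M. x \<in> {x \<in> space M. U x = \<infinity>} \<longrightarrow> complex_cond_exp M F (\<lambda>y. cnj (w y) * f y) x = 0"
  proof (rule complex_cond_exp_eq_0_on[OF level_set_U])
    show "AE x in M. x \<in> {x \<in> space M. U x = \<infinity>} \<longrightarrow> cnj (w x) * f x = 0"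
      using w_eq_0 by eventually_elim simp
  qed measurable
  moreover have "AE x in M. x \<in> G \<longrightarrow> complex_cond_exp M F (\<lambda>y. cnj (w y) * f y) x
      = complex_cond_exp M F (\<lambda>y. cnj (coeff w y) * (cnj (v y) * f y)) x"
  proof (rule complex_cond_exp_cong_on[OF G_sets])
    show "AE x in M. x \<in> G \<longrightarrow> cnj (w x) * f x = cnj (coeff w x) * (cnj (v x) * f x)"
      using w_eq by eventually_elim simp
  qed measurable
  moreover have "AE x in M. complex_cond_exp M F (\<lambda>y. cnj (coeff w y) * (cnj (v y) * f y)) x
      = cnj (coeff w x) * complex_cond_exp M F (\<lambda>y. cnj (v y) * f y) x"
    by (rule complex_cond_exp_mult[OF _ coeff_dom[OF f]]) measurable
  ultimately show ?thesis
    using \<phi>_eq u_eq_0 AE_space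
  proof eventually_elim
    case (elim x)
    show ?case
    proof (cases "x \<in> G")
      case True
      then have "weighted_cond_exp M F (\<lambda>x. cnj (u x)) (\<lambda>x. cnj (w x)) f x
          = complex_of_real (s x) * v x * (cnj (coeff w x) * coeff f x)"
        using elim by (simp add: weighted_cond_exp_def coeff_def u_eq)
      then show ?thesis using elim True by (simp add: proj_def)
    next
      case False
      then have "U x = 0 \<or> U x = \<infinity>" using elim by (auto simp: G_def)
      then show ?thesis using elim proj_eq_0[OF False, of f] by (auto simp: weighted_cond_exp_def)
    qed
  qed
qed

end

section \<open>The spectrum of a weighted conditional expectation\<close>

theorem theorem4p3:
  fixes M F :: "'a measure" and u w :: "'a \<Rightarrow> complex"
  assumes "complete_measure M" and "sigma_finite_measure M"
    and "sigma_finite_subalgebra M F"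
    and "u \<in> cond_exp_dom M F" and "w \<in> cond_exp_dom M F"
    and "bounded_L2_op M (weighted_cond_exp M F w u)"
    and "AE x in M. nn_cond_exp M F (\<lambda>y. ennreal ((cmod (u y))\<^sup>2)) x \<noteq> 0 \<longrightarrow>
        ennreal (cmod (complex_cond_exp M F (\<lambda>y. u y * w y) x)) =
          ennreal_sqrt (nn_cond_exp M F (\<lambda>y. ennreal ((cmod (u y))\<^sup>2)) x) *
          ennreal_sqrt (nn_cond_exp M F (\<lambda>y. ennreal ((cmod (w y))\<^sup>2)) x)"
  shows
    "(L2_joint_point_spectrum M (weighted_cond_exp M F w u) - {0} =
        L2_point_spectrum M (weighted_cond_exp M F w u) - {0} \<and>
      L2_point_spectrum M (weighted_cond_exp M F w u) - {0} =
        {z. emeasure M {x \<in> space M. complex_cond_exp M F (\<lambda>y. u y * w y) x = z} > 0} - {0}) \<and>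
     L2_spectrum M (weighted_cond_exp M F w u) - {0} =
       {z. cnj z \<in> L2_approx_point_spectrum M
              (weighted_cond_exp M F (\<lambda>x. cnj (u x)) (\<lambda>x. cnj (w x)))} - {0} \<and>
     (\<forall>z. z isolated_in (L2_spectrum M (weighted_cond_exp M F w u)) \<longrightarrow>
       z \<in> L2_point_spectrum M (weighted_cond_exp M F w u))"
proof -
  have uw: "u \<in> borel_measurable M" "w \<in> borel_measurable M"
    using assms(4,5) by (simp_all add: cond_exp_dom_def)
  interpret cauchy_schwarz_equality M F u w
    using assms(3,7) uw by (simp add: cauchy_schwarz_equality_def cauchy_schwarz_equality_axioms_def)
  let ?T = "weighted_cond_exp M F w u"
  let ?S = "weighted_cond_exp M F (\<lambda>x. cnj (u x)) (\<lambda>x. cnj (w x))"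
  have measurable_op: "weighted_cond_exp M F a b f \<in> borel_measurable M"
    if "a \<in> borel_measurable M" for a b f :: "'a \<Rightarrow> complex"
    using that unfolding weighted_cond_exp_def by measurable
  obtain C where C: "\<And>f. f \<in> L2_space M \<Longrightarrow> L2_norm M (?T f) \<le> C * L2_norm M f"
    using assms(6) unfolding bounded_L2_op_def by blast
  have T_eq: "AE x in M. ?T f x = \<phi> x * proj f x" if "f \<in> L2_space M" for f
    by (rule weighted_cond_exp_eq[OF L2_spaceD(1)[OF that]])
  have T_L2: "?T f \<in> L2_space M" if "f \<in> L2_space M" for f
    using assms(6) that unfolding bounded_L2_op_def by blast
  have \<phi>_bound: "AE x in M. x \<in> G \<longrightarrow> cmod (\<phi> x) \<le> \<bar>C\<bar> + 1"
    by (rule multiplier_bounded_of_norm_bound[OF \<phi>_measurable T_L2 T_eq C])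
  have T: "multiplied_projection M F v G \<phi> ?T"
    by unfold_locales (use \<phi>_measurable \<phi>_bound T_eq measurable_op[OF uw(2)] in auto)
  have S: "multiplied_projection M F v G (\<lambda>x. cnj (\<phi> x)) ?S"
  proof unfold_locales
    show "(\<lambda>x. cnj (\<phi> x)) \<in> borel_measurable F" using \<phi>_measurable by measurable
    show "\<exists>C. AE x in M. x \<in> G \<longrightarrow> cmod (cnj (\<phi> x)) \<le> C" using \<phi>_bound by auto
    show "?S f \<in> borel_measurable M" for f
      by (rule measurable_op[OF borel_measurable_cnj[OF uw(1)]])
    show "AE x in M. ?S f x = cnj (\<phi> x) * proj f x" if "f \<in> L2_space M" for f
      by (rule weighted_cond_exp_cnj_eq[OF L2_imp_cond_L2[OF that]])
  qed
  interpret T: multiplied_projection M F v G \<phi> ?T by (rule T)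
  interpret S: multiplied_projection M F v G "\<lambda>x. cnj (\<phi> x)" ?S by (rule S)
  have level: "emeasure M {x \<in> space M. \<phi> x = z} > 0 \<longleftrightarrow> \<not> (AE x in M. x \<in> G \<longrightarrow> \<phi> x \<noteq> z)"
    if "z \<noteq> 0" for z
  proof -
    have "emeasure M {x \<in> space M. \<phi> x = z} = 0 \<longleftrightarrow> (AE x in M. \<phi> x \<noteq> z)"
      by (rule AE_iff_measurable[symmetric]) auto
    also have "\<dots> \<longleftrightarrow> (AE x in M. x \<in> G \<longrightarrow> \<phi> x \<noteq> z)"
    proof
      assume "AE x in M. x \<in> G \<longrightarrow> \<phi> x \<noteq> z"
      with \<phi>_eq_0 show "AE x in M. \<phi> x \<noteq> z"
        by eventually_elim (use that in auto)
    qed auto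
    finally show ?thesis by (simp add: zero_less_iff_neq_zero)
  qed
  have point_imp_level: "\<not> (AE x in M. x \<in> G \<longrightarrow> \<phi> x \<noteq> z)"
    if "z \<in> L2_point_spectrum M ?T" "z \<noteq> 0" for z
    by (rule T.eigenvalue_imp_level_set[OF that])
  have level_imp_joint: "z \<in> L2_joint_point_spectrum M ?T"
    if level_z: "\<not> (AE x in M. x \<in> G \<longrightarrow> \<phi> x \<noteq> z)" for z
  proof -
    obtain f where f: "f \<in> L2_space M" "L2_norm M f = 1" and pf: "AE x in M. proj f x = f x"
      and supp: "\<And>x. f x \<noteq> 0 \<Longrightarrow> \<phi> x = z"
      using T.level_set_imp_eigenvector[OF level_z] by blast
    have "AE x in M. L2_adjoint M ?T f x = ?S f x"
      by (rule L2_adjoint_eq[OF S.bounded_T multiplied_projection_adjoint[OF T S] f(1)])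
    moreover have "AE x in M. ?S f x - cnj z * f x = 0"
      by (rule S.eigenvectorI[OF f(1) pf]) (simp add: supp)
    ultimately have "AE x in M. L2_adjoint M ?T f x - cnj z * f x = 0"
      by eventually_elim simp
    moreover have "AE x in M. ?T f x - z * f x = 0"
      by (rule T.eigenvectorI[OF f(1) pf supp])
    ultimately show ?thesis using f unfolding L2_joint_point_spectrum_def by blast
  qed
  have joint_imp_point: "L2_joint_point_spectrum M ?T \<subseteq> L2_point_spectrum M ?T"
    unfolding L2_joint_point_spectrum_def L2_point_spectrum_def by blast
  have a1: "L2_joint_point_spectrum M ?T - {0} = L2_point_spectrum M ?T - {0}"
    using point_imp_level level_imp_joint joint_imp_point by blast
  have a2: "L2_point_spectrum M ?T - {0} = {z. emeasure M {x \<in> space M. \<phi> x = z} > 0} - {0}"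
    using point_imp_level level_imp_joint joint_imp_point level by blast
  have b: "z \<in> L2_spectrum M ?T \<longleftrightarrow> cnj z \<in> L2_approx_point_spectrum M ?S" if "z \<noteq> 0" for z
  proof -
    have "cmod (cnj (\<phi> x) - cnj z) = cmod (\<phi> x - z)" for x
      by (metis complex_cnj_diff complex_mod_cnj)
    then have "z \<in> L2_spectrum M ?T \<longleftrightarrow> cnj z \<in> L2_spectrum M ?S"
      using T.spectrum_iff[OF that] S.spectrum_iff[of "cnj z"] that by simp
    also have "\<dots> \<longleftrightarrow> cnj z \<in> L2_approx_point_spectrum M ?S"
      using S.approx_point_spectrum_eq_spectrum that by auto
    finally show ?thesis .
  qed
  have "L2_spectrum M ?T - {0} = {z. cnj z \<in> L2_approx_point_spectrum M ?S} - {0}"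
    using b by auto
  then show ?thesis
    using a1 a2 T.isolated_spectrum_imp_eigenvalue unfolding \<phi>_def by simp
qed

end
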